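(* Let $K$ be a field, $S=K[x_1,\dots,x_n]$, and let $\mathcal{C}$ be a $d$-uniform clutter on $[n]$. Let $e\in\mathrm{Simp}(\mathcal{C})$ be a simplicial element of $\mathcal{C}$, let $A\subseteq\{F\in\mathcal{C} : e\subset F\}$, and let $\mathcal{D}=\mathcal{C}\setminus A$ (set difference of collections of circuits). Then $$\beta_{i,i+j}\left(I(\bar{\mathcal{C}})\right)=\beta_{i,i+j}\left(I(\bar{\mathcal{D}})\right)\quad\text{for all } i \text{ and all } j>d.$$ Consequently, if $\mathcal{C}\neq\mathcal{C}_{n,d}$: (a) $\mathrm{reg}\left(I(\bar{\mathcal{C}})\right)=\mathrm{reg}\left(I(\bar{\mathcal{D}})\right)$; (b) $\mathrm{index}\left(I(\bar{\mathcal{C}})\right)=\mathrm{index}\left(I(\bar{\mathcal{D}})\right)$; (c) $\mathrm{projdim}\left(I(\bar{\mathcal{C}})\right)\le\mathrm{projdim}\left(I(\bar{\mathcal{D}})\right)$.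
   Context: $S=K[x_1,\dots,x_n]$ has the standard grading. For a finitely generated graded $S$-module $M$, $\beta_{i,j}(M)=\dim_K\mathrm{Tor}^S_i(K,M)_j$; for $M\ne 0$, $\mathrm{projdim}(M)=\max\{i:\beta_{i,i+j}(M)\ne0\text{ for some }j\}$, $\mathrm{reg}(M)=\sup\{j-i:\beta_{i,j}(M)\neq0\}$, $\mathrm{indeg}(M)=\inf\{i:M_i\ne0\}$. A nonzero homogeneous ideal $I$ is $r$ steps linear if $\beta_{i,i+j}(I)=0$ for all $0\le i\le r$ and $j>\mathrm{indeg}(I)$; $\mathrm{index}(I)=\sup\{r: I\text{ is } r\text{ steps linear}\}+1$ (possibly $\infty$). A $d$-uniform clutter $\mathcal{C}$ on $[n]=\{1,\dots,n\}$ is a collection of $d$-element subsets of $[n]$, called circuits. $\mathcal{C}_{n,d}$ is the collection of all $d$-subsets of $[n]$, and $\bar{\mathcal{C}}=\mathcal{C}_{n,d}\setminus\mathcal{C}$. For a clutter $\mathcal{C}$, $I(\mathcal{C})=(\mathbf{x}_T: T\in\mathcal{C})\subset S$ where $\mathbf{x}_T=\prod_{i\in T}x_i$, and $I(\varnothing)=0$. A subset $V\subseteq[n]$ is a clique in $\mathcal{C}$ if all $d$-subsets of $V$ belong to $\mathcal{C}$ (so subsets with fewer than $d$ elements are cliques). For a $(d-1)$-subset $e\subset[n]$, $N_{\mathcal{C}}[e]=e\cup\{c\in[n]: e\cup\{c\}\in\mathcal{C}\}$; $e$ is simplicial in $\mathcal{C}$ if $N_{\mathcal{C}}[e]$ is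 a clique in $\mathcal{C}$, and $\mathrm{Simp}(\mathcal{C})$ is the set of all simplicial $(d-1)$-subsets. *)

theory Defs
  imports
    Complex_Main
    "HOL-Library.Poly_Mapping"
    "HOL-Library.Function_Algebras"
    "HOL-Library.Extended_Real"
    "HOL-Algebra.Ideal"
begin

section \<open>The polynomial ring $S = K[x_1,\dots,x_n]$\<close>

text \<open>A polynomial is a finitely supported function from exponent vectors to coefficients.
  The type admits variables \<open>x\<^sub>i\<close> for all natural numbers \<open>i\<close>; the ring \<open>S\<close> is the subring of
  those polynomials in which only \<open>x\<^sub>1, \<dots>, x\<^sub>n\<close> occur.\<close>

type_synonym 'k mpoly = "(nat \<Rightarrow>\<^sub>0 nat) \<Rightarrow>\<^sub>0 'k"

definition var :: "nat \<Rightarrow> 'k::field mpoly" where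
  "var i = Poly_Mapping.single (Poly_Mapping.single i 1) 1"

definition const :: "'k::field \<Rightarrow> 'k mpoly" where
  "const c = Poly_Mapping.single 0 c"

definition poly_carrier :: "nat \<Rightarrow> 'k::field mpoly set" where
  "poly_carrier n = {f. \<forall>m\<in>Poly_Mapping.keys f. Poly_Mapping.keys m \<subseteq> {1..n}}"

definition poly_ring :: "nat \<Rightarrow> ('k::field mpoly) ring" where
  "poly_ring n = \<lparr>carrier = poly_carrier n, monoid.mult = (*), one = 1, zero = 0, add = (+)\<rparr>"

definition mon_degree :: "(nat \<Rightarrow>\<^sub>0 nat) \<Rightarrow> nat" where
  "mon_degree m = (\<Sum>i\<in>Poly_Mapping.keys m. Poly_Mapping.lookup m i)"

text \<open>The graded piece \<open>S\<^sub>j\<close>; it is \<open>{0}\<close> for negative \<open>j\<close>.\<close>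

definition poly_part :: "nat \<Rightarrow> int \<Rightarrow> 'k::field mpoly set" where
  "poly_part n j = {f \<in> poly_carrier n. \<forall>m\<in>Poly_Mapping.keys f. int (mon_degree m) = j}"

section \<open>Graded modules\<close>

text \<open>A graded \<open>S\<close>-module is given by the scalar multiplication and by its graded pieces
  \<open>M\<^sub>j\<close> (\<open>j \<in> \<int>\<close>), which sit inside an ambient abelian group; the module itself is their direct sum.\<close>

record (overloaded) ('k, 'm) graded_module =
  act :: "'k mpoly \<Rightarrow> 'm \<Rightarrow> 'm"
  part :: "int \<Rightarrow> 'm set"

definition ring_module :: "nat \<Rightarrow> ('k::field, 'k mpoly) graded_module" where
  "ring_module n = \<lparr>act = (*), part = poly_part n\<rparr>"

definition ideal_module :: "nat \<Rightarrow> 'k::field mpoly set \<Rightarrow> ('k, 'k mpoly) graded_module" where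
  "ideal_module n I = \<lparr>act = (*), part = (\<lambda>j. I \<inter> poly_part n j)\<rparr>"

text \<open>$K = S/(x_1,\dots,x_n)$, concentrated in degree 0.\<close>

definition residue_field :: "('k::field, 'k) graded_module" where
  "residue_field =
    \<lparr>act = (\<lambda>p c. Poly_Mapping.lookup p 0 * c), part = (\<lambda>j. if j = 0 then UNIV else {0})\<rparr>"

section \<open>Graded free resolutions\<close>

text \<open>A sequence of finitely generated graded free modules
  $F_i = \bigoplus_{k<\mathrm{rk}\,i} S(-\mathrm{shift}\,i\,k)$, with basis element $\epsilon_{i,k}$ in
  degree \<open>shift i k\<close>, and maps $F_{i+1} \to F_i$,
  $\epsilon_{i+1,l} \mapsto \sum_{k<\mathrm{rk}\,i} (\mathrm{dmat}\,i\,k\,l)\,\epsilon_{i,k}$.\<close>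

record (overloaded) 'k free_complex =
  rk :: "nat \<Rightarrow> nat"
  shift :: "nat \<Rightarrow> nat \<Rightarrow> int"
  dmat :: "nat \<Rightarrow> nat \<Rightarrow> nat \<Rightarrow> 'k mpoly"

text \<open>The degree \<open>j\<close> part of $F_i \otimes_S M = \bigoplus_{k<\mathrm{rk}\,i} M(-\mathrm{shift}\,i\,k)$,
  whose elements $\sum_k \epsilon_{i,k} \otimes v_k$ are represented by the coefficient families \<open>v\<close>.
  For \<open>M = S\<close> this is the degree \<open>j\<close> part of \<open>F\<^sub>i\<close> itself.\<close>

definition chains ::
    "'k::field free_complex \<Rightarrow> ('k, 'm::ab_group_add) graded_module \<Rightarrow> nat \<Rightarrow> int \<Rightarrow> (nat \<Rightarrow> 'm) set" where
  "chains F M i j =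
    {v. (\<forall>k<rk F i. v k \<in> part M (j - shift F i k)) \<and> (\<forall>k\<ge>rk F i. v k = 0)}"

definition bd ::
    "'k::field free_complex \<Rightarrow> ('k, 'm::ab_group_add) graded_module \<Rightarrow> nat \<Rightarrow> (nat \<Rightarrow> 'm) \<Rightarrow> (nat \<Rightarrow> 'm)" where
  "bd F M i v = (\<lambda>k. if k < rk F i then \<Sum>l<rk F (Suc i). act M (dmat F i k l) (v l) else 0)"

fun cycles ::
    "'k::field free_complex \<Rightarrow> ('k, 'm::ab_group_add) graded_module \<Rightarrow> nat \<Rightarrow> int \<Rightarrow> (nat \<Rightarrow> 'm) set" where
  "cycles F M 0 j = chains F M 0 j"
| "cycles F M (Suc i) j = {v \<in> chains F M (Suc i) j. bd F M i v = (\<lambda>_. 0)}"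

definition boundaries ::
    "'k::field free_complex \<Rightarrow> ('k, 'm::ab_group_add) graded_module \<Rightarrow> nat \<Rightarrow> int \<Rightarrow> (nat \<Rightarrow> 'm) set" where
  "boundaries F M i j = bd F M i ` chains F M (Suc i) j"

text \<open>\<open>F\<close> is a graded free resolution of \<open>N\<close> with augmentation $F_0 \to N$,
  $\epsilon_{0,k} \mapsto \mathrm{aug}\,k$. All maps are homogeneous of degree 0, so exactness of
  $\cdots \to F_1 \to F_0 \to N \to 0$ is exactness in every degree \<open>j\<close>.\<close>

definition is_graded_free_resolution ::
    "nat \<Rightarrow> ('k::field, 'm::ab_group_add) graded_module \<Rightarrow> 'k free_complex \<Rightarrow> (nat \<Rightarrow> 'm) \<Rightarrow> bool" where
  "is_graded_free_resolution n N F aug \<longleftrightarrow>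
    (\<forall>i. \<forall>k<rk F i. \<forall>l<rk F (Suc i). dmat F i k l \<in> poly_part n (shift F (Suc i) l - shift F i k)) \<and>
    (\<forall>k<rk F 0. aug k \<in> part N (shift F 0 k)) \<and>
    (\<forall>j. (\<lambda>v. \<Sum>k<rk F 0. act N (v k) (aug k)) ` chains F (ring_module n) 0 j = part N j) \<and>
    (\<forall>j. {v \<in> chains F (ring_module n) 0 j. (\<Sum>k<rk F 0. act N (v k) (aug k)) = 0}
          = boundaries F (ring_module n) 0 j) \<and>
    (\<forall>i j. cycles F (ring_module n) (Suc i) j = boundaries F (ring_module n) (Suc i) j)"

section \<open>Tor and graded Betti numbers\<close>

text \<open>$\dim_K \mathrm{Tor}^S_i(N,M)_j = \dim_K H_i(F \otimes_S M)_j$ for a graded free resolution \<open>F\<close>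
  of \<open>N\<close>. The isomorphism class of Tor is independent of the resolution, so an arbitrary one is chosen.
  The chosen resolution consists of modules of finite rank; if \<open>M\<close> is finitely generated, the pieces
  $(F_i \otimes_S M)_j$ are finite-dimensional and the dimension of the homology, the quotient of cycles by
  boundaries, is the difference of the dimensions.\<close>

definition tor_dim ::
    "nat \<Rightarrow> ('k::field, 'a::ab_group_add) graded_module \<Rightarrow> ('k, 'm::ab_group_add) graded_module
      \<Rightarrow> nat \<Rightarrow> int \<Rightarrow> nat" where
  "tor_dim n N M i j =
    (let F = (SOME F. \<exists>aug. is_graded_free_resolution n N F aug);
         dim = vector_space.dim (\<lambda>(c::'k) (v::nat \<Rightarrow> 'm) k. act M (const c) (v k))
     in dim (cycles F M i j) - dim (boundaries F M i j))"

definition betti :: "nat \<Rightarrow> ('k::field, 'm::ab_group_add) graded_module \<Rightarrow> nat \<Rightarrow> int \<Rightarrow> nat" where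
  "betti n M i j = tor_dim n (residue_field :: ('k, 'k) graded_module) M i j"

definition projdim :: "nat \<Rightarrow> ('k::field, 'm::ab_group_add) graded_module \<Rightarrow> nat" where
  "projdim n M = Max {i. \<exists>j. betti n M i (int i + j) \<noteq> 0}"

definition reg :: "nat \<Rightarrow> ('k::field, 'm::ab_group_add) graded_module \<Rightarrow> ereal" where
  "reg n M = Sup {ereal (real_of_int (j - int i)) | i j. betti n M i j \<noteq> 0}"

definition indeg :: "('k::field, 'm::ab_group_add) graded_module \<Rightarrow> int" where
  "indeg M = Inf {i. part M i \<noteq> {0}}"

text \<open>The following two notions are meant for nonzero homogeneous ideals. The supremum of the empty
  set is \<open>-\<infinity>\<close>; it does not occur for ideals generated in a single degree, which are 0 steps linear.\<close>

definition steps_linear :: "nat \<Rightarrow> 'k::field mpoly set \<Rightarrow> nat \<Rightarrow> bool" where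
  "steps_linear n I r \<longleftrightarrow>
    (\<forall>i\<le>r. \<forall>j>indeg (ideal_module n I). betti n (ideal_module n I) i (int i + j) = 0)"

definition linearity_index :: "nat \<Rightarrow> 'k::field mpoly set \<Rightarrow> ereal" where
  "linearity_index n I = Sup {ereal (real r) | r. steps_linear n I r} + 1"

section \<open>Clutters\<close>

definition all_circuits :: "nat \<Rightarrow> nat \<Rightarrow> nat set set" where
  "all_circuits n d = {T. T \<subseteq> {1..n} \<and> card T = d}"

definition uniform_clutter :: "nat \<Rightarrow> nat \<Rightarrow> nat set set \<Rightarrow> bool" where
  "uniform_clutter n d C \<longleftrightarrow> C \<subseteq> all_circuits n d"

definition clutter_compl :: "nat \<Rightarrow> nat \<Rightarrow> nat set set \<Rightarrow> nat set set" where
  "clutter_compl n d C = all_circuits n d - C"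

text \<open>The first argument only fixes the coefficient field.\<close>

definition circuit_ideal :: "'k::field itself \<Rightarrow> nat \<Rightarrow> nat set set \<Rightarrow> 'k mpoly set" where
  "circuit_ideal K n C = genideal (poly_ring n) ((\<lambda>T. \<Prod>i\<in>T. var i) ` C)"

definition is_clique :: "nat \<Rightarrow> nat \<Rightarrow> nat set set \<Rightarrow> nat set \<Rightarrow> bool" where
  "is_clique n d C V \<longleftrightarrow> V \<subseteq> {1..n} \<and> (\<forall>T. T \<subseteq> V \<and> card T = d \<longrightarrow> T \<in> C)"

definition closed_nbhd :: "nat \<Rightarrow> nat set set \<Rightarrow> nat set \<Rightarrow> nat set" where
  "closed_nbhd n C e = e \<union> {c \<in> {1..n}. e \<union> {c} \<in> C}"

text \<open>Writing \<open>card e + 1 = d\<close> instead of \<open>card e = d - 1\<close> rules out \<open>d = 0\<close>, where truncated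
  subtraction would allow \<open>e = {}\<close>.\<close>

definition Simp :: "nat \<Rightarrow> nat \<Rightarrow> nat set set \<Rightarrow> nat set set" where
  "Simp n d C = {e. e \<subseteq> {1..n} \<and> card e + 1 = d \<and> is_clique n d C (closed_nbhd n C e)}"

end

theory Submission
  imports Defs
begin

text \<open>
  Let \<open>F = e \<union> {c}\<close> be a single circuit containing the simplicial element \<open>e\<close>; removing it from
  \<open>C\<close> leaves \<open>e\<close> simplicial, so it is enough to remove one circuit at a time. Write \<open>I\<close> and
  \<open>I' = I + (x\<^sub>F)\<close> for the two ideals and \<open>W\<close> for the set of variables outside the closed
  neighbourhood of \<open>e\<close>. Since the neighbourhood is a clique, \<open>I : x\<^sub>F = (W)\<close>, hence
  \<open>I'/I\<close> is isomorphic to \<open>(S/(W))(-d)\<close> and has a \<open>d\<close>-linear resolution. The long exact sequence of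
  Tor gives the equality of the Betti numbers outside the strands \<open>d\<close> and \<open>d + 1\<close>, and an inequality
  in the strand \<open>d\<close>. In the strand \<open>d + 1\<close> the only obstruction is the connecting map
  $\mathrm{Tor}_{i+1}(K, I'/I)_{i+1+d} \to \mathrm{Tor}_i(K, I)_{i+1+d}$. Because \<open>x\<^sub>e (W) \<subseteq> I\<close> and
  \<open>I \<inter> (x\<^sub>F) = x\<^sub>F (W) \<subseteq> x\<^sub>e (W)\<close>, it factors through $\mathrm{Tor}_i(K, x_e (W))_{i+1+d}$, which is 0
  since \<open>x\<^sub>e (W)\<close> has a \<open>d\<close>-linear resolution. This is \<open>tor_dimension_add_monomial\<close>, applied to clutters in
  \<open>betti_remove_circuit\<close>.

  The statements on regularity, index and projective dimension follow once it is known that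
  \<open>\<beta>\<^sub>0\<^sub>,\<^sub>d \<noteq> 0\<close> for a nonzero ideal generated in degree \<open>d\<close> (\<open>betti_circuit_ideal_nonzero\<close>) and that the
  projective dimension of a monomial ideal is finite (\<open>tor_dimension_Taylor\<close>).

  Tor is computed from an arbitrary finitely generated graded free resolution of \<open>K\<close>, and no
  comparison of resolutions is needed: the vanishing of Tor for \<open>S/(W)\<close>, and Taylor's bound, are
  obtained by adding one monomial at a time, starting from the exactness of the resolution
  (\<open>tor_vanishes_variables\<close>, \<open>tor_vanishes_Taylor\<close>). That a resolution exists is shown by iterating
  mapping cones, which amounts to the Koszul complex (\<open>residue_field_resolution_exists\<close>).
\<close>

abbreviation keys where "keys \<equiv> Poly_Mapping.keys"
abbreviation lookup where "lookup \<equiv> Poly_Mapping.lookup"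
abbreviation single where "single \<equiv> Poly_Mapping.single"

section \<open>Exponents and monomial ideals\<close>

text \<open>The exponent vectors of the monomials of \<open>S\<close>.\<close>

definition exponents :: "nat \<Rightarrow> (nat \<Rightarrow>\<^sub>0 nat) set" where
  "exponents n = {m. keys m \<subseteq> {1..n}}"

text \<open>The linear span of the monomials with exponents in \<open>U\<close>. All ideals below are of this form.\<close>

definition monomial_span :: "(nat \<Rightarrow>\<^sub>0 nat) set \<Rightarrow> 'k::field mpoly set" where
  "monomial_span U = {f. keys f \<subseteq> U}"

text \<open>The exponent sets whose spans are ideals.\<close>

definition upset :: "nat \<Rightarrow> (nat \<Rightarrow>\<^sub>0 nat) set \<Rightarrow> bool" where
  "upset n U \<longleftrightarrow> U \<subseteq> exponents n \<and> (\<forall>a\<in>exponents n. \<forall>b\<in>U. a + b \<in> U)"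

text \<open>The exponents of the monomials divisible by one of the monomials with exponent in \<open>G\<close>.\<close>

definition generated :: "nat \<Rightarrow> (nat \<Rightarrow>\<^sub>0 nat) set \<Rightarrow> (nat \<Rightarrow>\<^sub>0 nat) set" where
  "generated n G = {m \<in> exponents n. \<exists>g\<in>G. \<forall>i. lookup g i \<le> lookup m i}"

lemma keys_add_nat: "keys (a + b :: nat \<Rightarrow>\<^sub>0 nat) = keys a \<union> keys b"
  by (auto simp: in_keys_iff lookup_add)

lemma exponents_add_iff: "a + b \<in> exponents n \<longleftrightarrow> a \<in> exponents n \<and> b \<in> exponents n"
  by (auto simp: exponents_def keys_add_nat)

lemma zero_in_exponents [simp]: "0 \<in> exponents n"
  by (simp add: exponents_def)

lemma mon_degree_superset:
  assumes "finite T" "keys m \<subseteq> T"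
  shows "mon_degree m = (\<Sum>i\<in>T. lookup m i)"
  unfolding mon_degree_def
  by (rule sum.mono_neutral_left) (use assms in \<open>auto simp: in_keys_iff\<close>)

lemma mon_degree_add: "mon_degree (a + b) = mon_degree a + mon_degree b"
proof -
  have fin: "finite (keys a \<union> keys b)" by simp
  show ?thesis
    using mon_degree_superset[OF fin, of a] mon_degree_superset[OF fin, of b]
      mon_degree_superset[OF fin, of "a + b"]
    by (simp add: keys_add_nat lookup_add sum.distrib)
qed

lemma mon_degree_zero [simp]: "mon_degree 0 = 0"
  by (simp add: mon_degree_def)

lemma mon_degree_eq_0_iff: "mon_degree m = 0 \<longleftrightarrow> m = 0"
  by (auto simp: mon_degree_def in_keys_iff intro!: poly_mapping_eqI)

lemma mon_degree_single [simp]: "mon_degree (single i a) = a"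
  by (simp add: mon_degree_def)

lemma finite_exponents_degree: "finite {m \<in> exponents n. mon_degree m = t}"
proof (rule finite_subset)
  show "{m \<in> exponents n. mon_degree m = t} \<subseteq>
    lookup -` {f. (\<forall>i. (i \<in> {1..n} \<longrightarrow> f i \<in> {..t}) \<and> (i \<notin> {1..n} \<longrightarrow> f i = 0))}"
  proof
    fix m assume m: "m \<in> {m \<in> exponents n. mon_degree m = t}"
    have "lookup m i \<le> mon_degree m" for i
    proof (cases "i \<in> keys m")
      case True
      then show ?thesis unfolding mon_degree_def
        by (intro member_le_sum) auto
    qed (simp add: in_keys_iff)
    moreover have "lookup m i = 0" if "i \<notin> {1..n}" for i
      using m that by (auto simp: exponents_def in_keys_iff)
    ultimately show "m \<in> lookup -` {f. (\<forall>i. (i \<in> {1..n} \<longrightarrow> f i \<in> {..t}) \<and> (i \<notin> {1..n} \<longrightarrow> f i = 0))}"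
      using m by auto
  qed
  show "finite (lookup -` {f::nat \<Rightarrow> nat. (\<forall>i. (i \<in> {1..n} \<longrightarrow> f i \<in> {..t}) \<and> (i \<notin> {1..n} \<longrightarrow> f i = 0))})"
    by (intro finite_vimageI finite_set_of_finite_funs)
       (auto simp: inj_on_def lookup_inject)
qed

lemma upset_exponents: "upset n (exponents n)"
  by (auto simp: upset_def exponents_add_iff)

lemma upset_empty: "upset n {}"
  by (auto simp: upset_def)

lemma upset_Un: "upset n U \<Longrightarrow> upset n V \<Longrightarrow> upset n (U \<union> V)"
  by (auto simp: upset_def)

lemma upset_generated: "upset n (generated n G)"
  unfolding upset_def
proof (intro conjI ballI)
  fix a b assume ab: "a \<in> exponents n" "b \<in> generated n G"
  then obtain g where "g \<in> G" "\<forall>i. lookup g i \<le> lookup b i" by (auto simp: generated_def)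
  then have "\<exists>g\<in>G. \<forall>i. lookup g i \<le> lookup (a + b) i"
    by (intro bexI[of _ g]) (auto simp: lookup_add trans_le_add2)
  then show "a + b \<in> generated n G" using ab by (auto simp: generated_def exponents_add_iff)
qed (auto simp: generated_def)

lemma generated_subset_exponents: "generated n G \<subseteq> exponents n"
  by (auto simp: generated_def)

lemma upset_shift:
  assumes "g \<in> exponents n" "upset n U"
  shows "upset n ((+) g ` U)"
  unfolding upset_def
proof (intro conjI ballI)
  show "(+) g ` U \<subseteq> exponents n"
    using assms by (auto simp: upset_def exponents_add_iff)
  fix a b assume "a \<in> exponents n" "b \<in> (+) g ` U"
  then obtain u where u: "u \<in> U" "b = g + u" by auto
  then have "a + u \<in> U" using assms \<open>a \<in> exponents n\<close> by (auto simp: upset_def)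
  then show "a + b \<in> (+) g ` U"
    using u by (auto simp: image_iff algebra_simps intro!: bexI[of _ "a + u"])
qed

lemma generated_insert:
  assumes "g \<in> exponents n"
  shows "generated n (insert g G) = (+) g ` exponents n \<union> generated n G"
proof -
  have "m \<in> (+) g ` exponents n"
    if "m \<in> exponents n" "\<forall>i. lookup g i \<le> lookup m i" for m
  proof
    show eq: "m = g + (m - g)"
      using that by (intro poly_mapping_eqI) (simp add: lookup_add lookup_minus)
    show "m - g \<in> exponents n"
      using that(1) eq exponents_add_iff by metis
  qed
  then show ?thesis
    using assms by (auto simp: generated_def exponents_add_iff lookup_add)
qed

text \<open>On the level of exponents, the colon ideal of a monomial ideal by a monomial.\<close>

lemma generated_colon:
  assumes "g \<in> exponents n"
  shows "(+) g ` exponents n \<inter> generated n G = (+) g ` generated n ((\<lambda>h. h - g) ` G)"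
proof -
  have *: "(\<exists>h\<in>G. \<forall>i. lookup h i \<le> lookup (g + a) i) \<longleftrightarrow>
      (\<exists>h\<in>(\<lambda>h. h - g) ` G. \<forall>i. lookup h i \<le> lookup a i)" for a
    by (simp add: lookup_add lookup_minus le_diff_conv add.commute)
  have "g + a \<in> generated n G \<longleftrightarrow> a \<in> generated n ((\<lambda>h. h - g) ` G)" for a
    using assms unfolding generated_def mem_Collect_eq * exponents_add_iff by blast
  moreover have "generated n ((\<lambda>h. h - g) ` G) \<subseteq> exponents n"
    by (auto simp: generated_def)
  ultimately show ?thesis by blast
qed

lemma keys_times_subset:
  assumes "upset n U" "keys p \<subseteq> exponents n" "keys q \<subseteq> U"
  shows "keys (p * q) \<subseteq> U"
  using keys_mult[of p q] assms unfolding upset_def by blast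

lemma keys_uminus: "keys (- p :: 'a \<Rightarrow>\<^sub>0 'b::ab_group_add) = keys p"
  by (auto simp: in_keys_iff)

lemma keys_minus_subset:
  "keys p \<subseteq> U \<Longrightarrow> keys q \<subseteq> U \<Longrightarrow> keys (p - q :: 'a \<Rightarrow>\<^sub>0 'b::ab_group_add) \<subseteq> U"
  using keys_diff[of p q] by blast

lemma keys_plus_subset: "keys p \<subseteq> U \<Longrightarrow> keys q \<subseteq> U \<Longrightarrow> keys (p + q) \<subseteq> U"
  using keys_add[of p q] by blast

lemma keys_sum_subset:
  assumes "\<And>i. i \<in> I \<Longrightarrow> keys (f i) \<subseteq> U"
  shows "keys (\<Sum>i\<in>I. f i :: 'a \<Rightarrow>\<^sub>0 'b::comm_monoid_add) \<subseteq> U"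
  using keys_sum[of f I] assms by blast

lemma lookup_single_times:
  "lookup (single g c * p) (g + m) = c * lookup (p :: (nat \<Rightarrow>\<^sub>0 nat) \<Rightarrow>\<^sub>0 'k::field) m"
proof -
  have "lookup (single g c * p) (g + m) =
      (\<Sum>l. lookup (single g c) l * (\<Sum>q. lookup p q when g + m = l + q))"
    by (simp add: lookup_mult)
  also have "\<dots> = (\<Sum>l. (c * (\<Sum>q. lookup p q when g + m = l + q)) when g = l)"
    by (intro Sum_any.cong) (simp add: lookup_single when_def)
  also have "\<dots> = c * lookup p m"
    by (simp add: eq_commute[of m])
  finally show ?thesis .
qed

lemma keys_single_times:
  assumes "c \<noteq> 0"
  shows "keys (single g c * p :: 'k::field mpoly) = (+) g ` keys p"
proof
  show "keys (single g c * p) \<subseteq> (+) g ` keys p"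
    using keys_mult[of "single g c" p] by (auto split: if_splits)
  show "(+) g ` keys p \<subseteq> keys (single g c * p)"
    using assms by (auto simp: in_keys_iff lookup_single_times)
qed

lemma sum_single_keys: "(\<Sum>m\<in>keys f. single m (lookup f m)) = f"
  by (intro poly_mapping_eqI) (auto simp: lookup_sum lookup_single when_def in_keys_iff sum.delta')

lemma divide_by_monomial:
  fixes f :: "'k::field mpoly"
  assumes "keys f \<subseteq> (+) g ` U"
  obtains p where "f = single g 1 * p" "keys p \<subseteq> U"
proof
  let ?p = "\<Sum>m\<in>keys f. single (m - g) (lookup f m)"
  have "m - g \<in> U \<and> g + (m - g) = m" if "m \<in> keys f" for m
    using assms that by auto
  then show "f = single g 1 * ?p" "keys ?p \<subseteq> U"
    by (auto simp: sum_distrib_left mult_single sum_single_keys intro!: keys_sum_subset split: if_splits)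
qed

lemma split_monomial_span:
  fixes f :: "'k::field mpoly"
  assumes "keys f \<subseteq> U \<union> V"
  obtains p q where "f = p + q" "keys p \<subseteq> keys f \<inter> U" "keys q \<subseteq> keys f \<inter> V"
proof
  let ?g = "\<lambda>m. single m (lookup f m)"
  have "sum ?g (keys f) = sum ?g (keys f \<inter> U) + sum ?g (keys f - U)"
    by (rule sum.Int_Diff) simp
  then show "f = sum ?g (keys f \<inter> U) + sum ?g (keys f - U)"
    by (simp add: sum_single_keys)
  show "keys (sum ?g (keys f \<inter> U)) \<subseteq> keys f \<inter> U"
    by (rule keys_sum_subset) auto
  show "keys (sum ?g (keys f - U)) \<subseteq> keys f \<inter> V"
    by (rule keys_sum_subset) (use assms in auto)
qed

lemma keys_const: "keys (const c) \<subseteq> {0}"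
  by (simp add: const_def)

lemma poly_carrier_eq: "poly_carrier n = monomial_span (exponents n)"
  by (auto simp: poly_carrier_def monomial_span_def exponents_def)

lemma poly_part_eq: "poly_part n j = monomial_span {m \<in> exponents n. int (mon_degree m) = j}"
  by (auto simp: poly_part_def poly_carrier_eq monomial_span_def)

lemma ring_poly_ring: "ring (poly_ring n :: 'k::field mpoly ring)"
proof (rule ringI)
  let ?R = "poly_ring n :: 'k mpoly ring"
  have mult: "x * y \<in> monomial_span (exponents n)"
    if "x \<in> monomial_span (exponents n)" "y \<in> monomial_span (exponents n)" for x y :: "'k mpoly"
    using that keys_times_subset[OF upset_exponents, of x n y] by (simp add: monomial_span_def)
  have add: "x + y \<in> monomial_span (exponents n)"
    if "x \<in> monomial_span (exponents n)" "y \<in> monomial_span (exponents n)" for x y :: "'k mpoly"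
    using that by (simp add: monomial_span_def keys_plus_subset)
  show "abelian_group ?R"
  proof (rule abelian_groupI)
    fix x assume "x \<in> carrier ?R"
    then show "\<exists>y\<in>carrier ?R. y \<oplus>\<^bsub>?R\<^esub> x = \<zero>\<^bsub>?R\<^esub>"
      by (intro bexI[of _ "- x"])
         (auto simp: poly_ring_def poly_carrier_eq monomial_span_def keys_uminus)
  qed (use add in \<open>auto simp: poly_ring_def poly_carrier_eq ac_simps\<close>,
       auto simp: monomial_span_def)
  show "Group.monoid ?R"
    by (rule monoidI) (use mult in \<open>auto simp: poly_ring_def poly_carrier_eq ac_simps\<close>,
       auto simp: monomial_span_def)
qed (auto simp: poly_ring_def algebra_simps)

lemma ideal_monomial_span:
  assumes "upset n U"
  shows "ideal (monomial_span U :: 'k::field mpoly set) (poly_ring n)"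
proof (rule idealI[OF ring_poly_ring])
  let ?R = "poly_ring n :: 'k mpoly ring" and ?I = "monomial_span U :: 'k mpoly set"
  interpret ring ?R by (rule ring_poly_ring)
  have sub: "?I \<subseteq> carrier ?R"
    using assms by (auto simp: poly_ring_def poly_carrier_eq monomial_span_def upset_def)
  show "subgroup ?I (add_monoid ?R)"
  proof (rule group.subgroupI)
    show "group (add_monoid ?R)" by (rule a_group)
    show "?I \<noteq> {}" by (auto simp: monomial_span_def intro!: exI[of _ 0])
    fix a assume a: "a \<in> ?I"
    have "(- a) \<oplus>\<^bsub>?R\<^esub> a = \<zero>\<^bsub>?R\<^esub>" by (simp add: poly_ring_def)
    moreover have na: "- a \<in> ?I" using a by (simp add: monomial_span_def keys_uminus)
    ultimately have "\<ominus>\<^bsub>?R\<^esub> a = - a"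
      using a sub by (intro minus_equality) auto
    then show "inv\<^bsub>add_monoid ?R\<^esub> a \<in> ?I" using na by (simp add: a_inv_def)
  next
    fix a b assume "a \<in> ?I" "b \<in> ?I"
    then show "a \<otimes>\<^bsub>add_monoid ?R\<^esub> b \<in> ?I"
      by (simp add: poly_ring_def monomial_span_def keys_plus_subset)
  qed (use sub in auto)
  fix a x assume "a \<in> ?I" "x \<in> carrier ?R"
  then show "x \<otimes>\<^bsub>?R\<^esub> a \<in> ?I"
    using keys_times_subset[OF assms, of x a] by (simp add: poly_ring_def poly_carrier_eq monomial_span_def)
  then show "a \<otimes>\<^bsub>?R\<^esub> x \<in> ?I" by (simp add: poly_ring_def mult.commute)
qed

lemma genideal_monomials:
  assumes G: "G \<subseteq> exponents n"
  shows "genideal (poly_ring n) ((\<lambda>g. single g (1::'k::field)) ` G) = monomial_span (generated n G)"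
proof
  let ?R = "poly_ring n :: 'k mpoly ring"
  interpret ring ?R by (rule ring_poly_ring)
  have "(\<lambda>g. single g (1::'k)) ` G \<subseteq> monomial_span (generated n G)"
    using G by (auto simp: monomial_span_def generated_def)
  then show "Idl\<^bsub>?R\<^esub> ((\<lambda>g. single g 1) ` G) \<subseteq> monomial_span (generated n G)"
    by (intro genideal_minimal ideal_monomial_span upset_generated)
  show "monomial_span (generated n G) \<subseteq> Idl\<^bsub>?R\<^esub> ((\<lambda>g. single g 1) ` G)"
  proof
    fix f :: "'k mpoly" assume f: "f \<in> monomial_span (generated n G)"
    let ?I = "Idl\<^bsub>?R\<^esub> ((\<lambda>g. single g (1::'k)) ` G)"
    have carr: "(\<lambda>g. single g (1::'k)) ` G \<subseteq> carrier ?R"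
      using G by (auto simp: poly_ring_def poly_carrier_eq monomial_span_def)
    interpret I: ideal ?I ?R by (rule genideal_ideal[OF carr])
    have mono: "single m c \<in> ?I" if m: "m \<in> generated n G" for m c
    proof -
      obtain g where g: "g \<in> G" "\<And>i. lookup g i \<le> lookup m i"
        using m by (auto simp: generated_def)
      have eq: "m = (m - g) + g"
        by (intro poly_mapping_eqI) (simp add: lookup_add lookup_minus g)
      have "m - g \<in> exponents n"
        using m eq exponents_add_iff[of "m - g" g n] by (auto simp: generated_def)
      then have "single (m - g) c \<in> carrier ?R"
        by (auto simp: poly_ring_def poly_carrier_eq monomial_span_def)
      moreover have "single g 1 \<in> ?I"
        using genideal_self[OF carr] g by auto
      ultimately have "single (m - g) c \<otimes>\<^bsub>?R\<^esub> single g 1 \<in> ?I"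
        by (intro I.I_l_closed)
      then show ?thesis using eq by (simp add: poly_ring_def mult_single)
    qed
    have zero: "0 \<in> ?I" using I.zero_closed by (simp add: poly_ring_def)
    have add: "x + y \<in> ?I" if "x \<in> ?I" "y \<in> ?I" for x y
      using I.a_closed[OF that] by (simp add: poly_ring_def)
    have "(\<Sum>m\<in>M. single m (lookup f m)) \<in> ?I" if "M \<subseteq> keys f" for M
      using finite_subset[OF that finite_keys] that
      by (induction M rule: finite_induct)
         (use f in \<open>auto simp: zero monomial_span_def intro!: add mono\<close>)
    from this[of "keys f"] show "f \<in> ?I" by (simp add: sum_single_keys)
  qed
qed

text \<open>The exponent of the squarefree monomial \<open>x\<^sub>T\<close>.\<close>

definition squarefree_exponent :: "nat set \<Rightarrow> (nat \<Rightarrow>\<^sub>0 nat)" where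
  "squarefree_exponent T = (\<Sum>i\<in>T. single i 1)"

lemma lookup_squarefree_exponent:
  assumes "finite T"
  shows "lookup (squarefree_exponent T) i = (if i \<in> T then 1 else 0)"
  using assms by (simp add: squarefree_exponent_def lookup_sum lookup_single when_def sum.delta)

lemma squarefree_exponent_le_iff:
  assumes "finite T"
  shows "(\<forall>i. lookup (squarefree_exponent T) i \<le> lookup m i) \<longleftrightarrow> T \<subseteq> keys m"
  using assms by (auto simp: lookup_squarefree_exponent in_keys_iff Suc_le_eq)

lemma keys_squarefree_exponent: "finite T \<Longrightarrow> keys (squarefree_exponent T) = T"
  by (auto simp: in_keys_iff lookup_squarefree_exponent split: if_splits)

lemma mon_degree_squarefree_exponent: "finite T \<Longrightarrow> mon_degree (squarefree_exponent T) = card T"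
  by (simp add: mon_degree_def keys_squarefree_exponent lookup_squarefree_exponent)

lemma prod_var_eq: "(\<Prod>i\<in>T. var i) = (single (squarefree_exponent T) 1 :: 'k::field mpoly)"
  unfolding squarefree_exponent_def
  by (induction T rule: infinite_finite_induct) (auto simp: var_def mult_single)

text \<open>The exponents of the monomials in \<open>I(C)\<close>: those whose support contains a circuit.\<close>

definition circuit_exponents :: "nat \<Rightarrow> nat set set \<Rightarrow> (nat \<Rightarrow>\<^sub>0 nat) set" where
  "circuit_exponents n C = {m \<in> exponents n. \<exists>T\<in>C. T \<subseteq> keys m}"

lemma all_circuits_finite: "finite (all_circuits n d)" "T \<in> all_circuits n d \<Longrightarrow> finite T"
  by (auto simp: all_circuits_def intro: finite_subset[OF _ finite_atLeastAtMost])

lemma circuit_exponents_generated: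
  assumes "C \<subseteq> all_circuits n d"
  shows "circuit_exponents n C = generated n (squarefree_exponent ` C)"
proof -
  have "(\<forall>i. lookup (squarefree_exponent T) i \<le> lookup m i) \<longleftrightarrow> T \<subseteq> keys m" if "T \<in> C" for T m
    using that assms by (intro squarefree_exponent_le_iff all_circuits_finite(2)[of T n d]) blast
  then show ?thesis
    by (simp add: circuit_exponents_def generated_def)
qed

lemma circuit_ideal_eq:
  assumes "C \<subseteq> all_circuits n d"
  shows "circuit_ideal (K::'k::field itself) n C = monomial_span (circuit_exponents n C)"
proof -
  have sub: "squarefree_exponent ` C \<subseteq> exponents n"
  proof
    fix m assume "m \<in> squarefree_exponent ` C"
    then obtain T where T: "T \<in> C" "m = squarefree_exponent T" by blast
    then have "T \<in> all_circuits n d" using assms by blast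
    then show "m \<in> exponents n"
      using keys_squarefree_exponent[OF all_circuits_finite(2)] T(2)
      unfolding exponents_def all_circuits_def by blast
  qed
  have "(\<lambda>T. \<Prod>i\<in>T. var i :: 'k mpoly) ` C = (\<lambda>g. single g 1) ` squarefree_exponent ` C"
    by (simp add: prod_var_eq image_image)
  then show ?thesis
    unfolding circuit_ideal_def circuit_exponents_generated[OF assms]
    by (simp only: genideal_monomials[OF sub])
qed

section \<open>Chains with coefficients in monomial ideals\<close>

text \<open>The degree \<open>j\<close> part of \<open>F\<^sub>i \<otimes> I\<close>, where \<open>I\<close> is spanned by the monomials in \<open>U\<close>.\<close>

definition monomial_chains ::
    "'k::field free_complex \<Rightarrow> (nat \<Rightarrow>\<^sub>0 nat) set \<Rightarrow> nat \<Rightarrow> int \<Rightarrow> (nat \<Rightarrow> 'k mpoly) set" where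
  "monomial_chains F U i j =
    {v. (\<forall>k<rk F i. keys (v k) \<subseteq> {m \<in> U. int (mon_degree m) = j - shift F i k})
      \<and> (\<forall>k\<ge>rk F i. v k = 0)}"

text \<open>The differential on \<open>F\<^sub>i\<close>, indexed by its source so that it is defined, as 0, on \<open>F\<^sub>0\<close> too.\<close>

definition differential :: "'k::field free_complex \<Rightarrow> nat \<Rightarrow> (nat \<Rightarrow> 'k mpoly) \<Rightarrow> (nat \<Rightarrow> 'k mpoly)" where
  "differential F i v =
    (\<lambda>k. case i of 0 \<Rightarrow> 0 | Suc i' \<Rightarrow> if k < rk F i' then \<Sum>l<rk F i. dmat F i' k l * v l else 0)"

lemma differential_0 [simp]: "differential F 0 v = 0"
  by (simp add: differential_def zero_fun_def)

lemma differential_zero [simp]: "differential F i 0 = 0"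
  by (auto simp: differential_def zero_fun_def split: nat.split)

lemma differential_add: "differential F i (v + w) = differential F i v + differential F i w"
  by (auto simp: differential_def fun_eq_iff algebra_simps sum.distrib split: nat.split)

lemma differential_minus: "differential F i (v - w) = differential F i v - differential F i w"
  by (auto simp: differential_def fun_eq_iff algebra_simps sum_subtractf split: nat.split)

lemma differential_mult:
  "differential F i (\<lambda>k. p * v k) = (\<lambda>k. p * differential F i v k)"
  by (auto simp: differential_def fun_eq_iff sum_distrib_left mult.left_commute split: nat.split)

lemma chains_ideal_module:
  assumes "U \<subseteq> exponents n"
  shows "chains F (ideal_module n (monomial_span U)) i j = monomial_chains F U i j"
proof -
  have "f \<in> monomial_span U \<inter> poly_part n t \<longleftrightarrow> keys f \<subseteq> {m \<in> U. int (mon_degree m) = t}"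
    for f :: "'a mpoly" and t
    using assms by (auto simp: monomial_span_def poly_part_eq)
  then show ?thesis
    by (simp add: chains_def monomial_chains_def ideal_module_def)
qed

lemma chains_ring_module: "chains F (ring_module n) i j = monomial_chains F (exponents n) i j"
  by (simp add: chains_def monomial_chains_def ring_module_def poly_part_eq monomial_span_def)

lemma bd_ideal_module: "bd F (ideal_module n I) i = differential F (Suc i)"
  by (simp add: bd_def differential_def ideal_module_def fun_eq_iff)

lemma bd_ring_module: "bd F (ring_module n) i = differential F (Suc i)"
  by (simp add: bd_def differential_def ring_module_def fun_eq_iff)

lemma monomial_chains_mono: "U \<subseteq> V \<Longrightarrow> v \<in> monomial_chains F U i j \<Longrightarrow> v \<in> monomial_chains F V i j"
  by (fastforce simp: monomial_chains_def)

lemma zero_in_monomial_chains [simp]: "0 \<in> monomial_chains F U i j"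
  by (simp add: monomial_chains_def)

lemma monomial_chains_add:
  "v \<in> monomial_chains F U i j \<Longrightarrow> w \<in> monomial_chains F U i j \<Longrightarrow> v + w \<in> monomial_chains F U i j"
  by (simp add: monomial_chains_def keys_plus_subset)

lemma monomial_chains_minus:
  "v \<in> monomial_chains F U i j \<Longrightarrow> w \<in> monomial_chains F U i j \<Longrightarrow> v - w \<in> monomial_chains F U i j"
  by (simp add: monomial_chains_def keys_minus_subset)

lemma monomial_chains_Int:
  "v \<in> monomial_chains F U i j \<Longrightarrow> v \<in> monomial_chains F V i j \<Longrightarrow> v \<in> monomial_chains F (U \<inter> V) i j"
  by (fastforce simp: monomial_chains_def)

lemma monomial_chains_empty: "v \<in> monomial_chains F {} i j \<longleftrightarrow> v = 0"
  by (auto simp: monomial_chains_def fun_eq_iff not_less[symmetric])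

lemma split_monomial_chains:
  assumes "v \<in> monomial_chains F (U \<union> V) i j"
  obtains a b where "v = a + b" "a \<in> monomial_chains F U i j" "b \<in> monomial_chains F V i j"
proof -
  have v: "keys (v k) \<subseteq> {m \<in> U \<union> V. int (mon_degree m) = j - shift F i k}" if "k < rk F i" for k
    using assms that by (auto simp: monomial_chains_def)
  have "\<exists>p q. v k = p + q \<and> keys p \<subseteq> keys (v k) \<inter> U \<and> keys q \<subseteq> keys (v k) \<inter> V" if k: "k < rk F i" for k
    using split_monomial_span[of "v k" U V] v[OF k] by (metis (no_types, lifting) mem_Collect_eq subset_iff)
  then obtain p q where pq: "\<And>k. k < rk F i \<Longrightarrow>
      v k = p k + q k \<and> keys (p k) \<subseteq> keys (v k) \<inter> U \<and> keys (q k) \<subseteq> keys (v k) \<inter> V"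
    by metis
  let ?a = "\<lambda>k. if k < rk F i then p k else 0" and ?b = "\<lambda>k. if k < rk F i then q k else 0"
  have "v = ?a + ?b"
    using assms pq by (auto simp: monomial_chains_def fun_eq_iff)
  moreover have "?a \<in> monomial_chains F U i j" "?b \<in> monomial_chains F V i j"
    using pq v unfolding monomial_chains_def by (simp, blast)+
  ultimately show thesis by (rule that)
qed

lemma monomial_chains_times:
  assumes "v \<in> monomial_chains F U i j"
  shows "(\<lambda>k. single g 1 * v k) \<in> monomial_chains F ((+) g ` U) i (j + int (mon_degree g))"
  using assms by (fastforce simp: monomial_chains_def keys_single_times mon_degree_add)

lemma monomial_chains_times_iff:
  "(\<lambda>k. single g 1 * v k) \<in> monomial_chains F ((+) g ` U) i (j + int (mon_degree g))
    \<longleftrightarrow> v \<in> monomial_chains F U i j"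
proof
  assume a: "(\<lambda>k. single g 1 * v k) \<in> monomial_chains F ((+) g ` U) i (j + int (mon_degree g))"
  have "v k = 0" if "k \<ge> rk F i" for k
  proof -
    have "keys (single g 1 * v k) = {}" using a that by (simp add: monomial_chains_def)
    then show ?thesis by (simp add: keys_single_times)
  qed
  moreover have "keys (v k) \<subseteq> {m \<in> U. int (mon_degree m) = j - shift F i k}" if "k < rk F i" for k
    using a that by (fastforce simp: monomial_chains_def keys_single_times mon_degree_add)
  ultimately show "v \<in> monomial_chains F U i j" by (simp add: monomial_chains_def)
qed (rule monomial_chains_times)

lemma divide_monomial_chains:
  assumes "v \<in> monomial_chains F ((+) g ` U) i (j + int (mon_degree g))"
  obtains w where "w \<in> monomial_chains F U i j" "v = (\<lambda>k. single g 1 * w k)"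
proof -
  have "\<exists>p. v k = single g 1 * p" for k
  proof (cases "k < rk F i")
    case True
    then have "keys (v k) \<subseteq> (+) g ` U" using assms by (auto simp: monomial_chains_def)
    then show ?thesis by (metis divide_by_monomial)
  next
    case False
    then show ?thesis using assms by (auto simp: monomial_chains_def intro!: exI[of _ 0])
  qed
  then obtain w where w: "\<And>k. v k = single g 1 * w k" by metis
  then have v: "v = (\<lambda>k. single g 1 * w k)" by auto
  show thesis
  proof (rule that)
    show "w \<in> monomial_chains F U i j" using assms unfolding v monomial_chains_times_iff .
  qed (fact v)
qed

lemma differential_chains:
  assumes homogeneous: "\<And>k l. k < rk F i \<Longrightarrow> l < rk F (Suc i) \<Longrightarrow>
      dmat F i k l \<in> poly_part n (shift F (Suc i) l - shift F i k)"
    and U: "upset n U" and v: "v \<in> monomial_chains F U (Suc i) j"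
  shows "differential F (Suc i) v \<in> monomial_chains F U i j"
proof -
  have "keys (dmat F i k l * v l) \<subseteq> {m \<in> U. int (mon_degree m) = j - shift F i k}"
    if "k < rk F i" "l < rk F (Suc i)" for k l
  proof
    fix m assume "m \<in> keys (dmat F i k l * v l)"
    then obtain a b where ab: "m = a + b" "a \<in> keys (dmat F i k l)" "b \<in> keys (v l)"
      using keys_mult by blast
    have "a \<in> exponents n" "int (mon_degree a) = shift F (Suc i) l - shift F i k"
      using ab homogeneous[OF that] by (auto simp: poly_part_eq monomial_span_def)
    moreover have "b \<in> U" "int (mon_degree b) = j - shift F (Suc i) l"
      using ab v that by (auto simp: monomial_chains_def)
    ultimately show "m \<in> {m \<in> U. int (mon_degree m) = j - shift F i k}"
      using U ab by (auto simp: upset_def mon_degree_add)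
  qed
  then have "keys (\<Sum>l<rk F (Suc i). dmat F i k l * v l) \<subseteq> {m \<in> U. int (mon_degree m) = j - shift F i k}"
    if "k < rk F i" for k
    using that by (intro keys_sum_subset) simp
  then show ?thesis by (simp add: monomial_chains_def differential_def)
qed

section \<open>Vanishing of Tor for monomial subquotients\<close>

text \<open>A resolution of the residue field \<open>K\<close> by finitely generated graded free modules, with the
  exactness at the end recorded only in degrees \<open>j \<noteq> 0\<close>, where \<open>K\<close> vanishes.\<close>

locale residue_resolution =
  fixes n :: nat and F :: "'k::field free_complex"
  assumes dmat_homogeneous:
      "k < rk F i \<Longrightarrow> l < rk F (Suc i) \<Longrightarrow> dmat F i k l \<in> poly_part n (shift F (Suc i) l - shift F i k)"
    and differential_differential:
      "v \<in> monomial_chains F (exponents n) (Suc i) j \<Longrightarrow> differential F i (differential F (Suc i) v) = 0"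
    and exact:
      "v \<in> monomial_chains F (exponents n) i j \<Longrightarrow> differential F i v = 0 \<Longrightarrow> i \<noteq> 0 \<or> j \<noteq> 0 \<Longrightarrow>
        \<exists>w\<in>monomial_chains F (exponents n) (Suc i) j. v = differential F (Suc i) w"
begin

abbreviation ch where "ch \<equiv> monomial_chains F"
abbreviation bdry where "bdry \<equiv> differential F"

lemma bdry_Suc_chains: "upset n U \<Longrightarrow> v \<in> ch U (Suc i) j \<Longrightarrow> bdry (Suc i) v \<in> ch U i j"
  by (rule differential_chains[OF dmat_homogeneous])

lemma bdry_chains: "upset n U \<Longrightarrow> v \<in> ch U i j \<Longrightarrow> bdry i v \<in> ch U (i - 1) j"
  by (cases i) (auto intro: bdry_Suc_chains)

lemma bdry_bdry: "upset n U \<Longrightarrow> v \<in> ch U (Suc i) j \<Longrightarrow> bdry i (bdry (Suc i) v) = 0"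
  by (rule differential_differential, rule monomial_chains_mono) (auto simp: upset_def)

text \<open>\<open>Tor\<^sub>i(K, I/J)\<^sub>j = 0\<close> for the ideals \<open>J \<subseteq> I\<close> spanned by the monomials in \<open>V \<subseteq> U\<close>: every chain
  with coefficients in \<open>I\<close> that is a cycle modulo \<open>J\<close> is a boundary modulo \<open>J\<close>. This avoids
  quotient modules. For \<open>i = 0\<close> the truncated index \<open>i - 1\<close> is harmless, since the differential on
  \<open>F\<^sub>0\<close> is 0.\<close>

definition tor_vanishes :: "(nat \<Rightarrow>\<^sub>0 nat) set \<Rightarrow> (nat \<Rightarrow>\<^sub>0 nat) set \<Rightarrow> nat \<Rightarrow> int \<Rightarrow> bool" where
  "tor_vanishes U V i j \<longleftrightarrow>
    (\<forall>v\<in>ch U i j. bdry i v \<in> ch V (i - 1) j \<longrightarrow> (\<exists>w\<in>ch U (Suc i) j. v - bdry (Suc i) w \<in> ch V i j))"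

lemma tor_vanishesD:
  assumes "tor_vanishes U V i j" "v \<in> ch U i j" "bdry i v \<in> ch V (i - 1) j"
  obtains w where "w \<in> ch U (Suc i) j" "v - bdry (Suc i) w \<in> ch V i j"
  using assms unfolding tor_vanishes_def by blast

lemma tor_vanishes_exponents: "i \<noteq> 0 \<or> j \<noteq> 0 \<Longrightarrow> tor_vanishes (exponents n) {} i j"
  using exact by (fastforce simp: tor_vanishes_def monomial_chains_empty)

text \<open>For \<open>V \<subseteq> U \<subseteq> W\<close>: \<open>Tor\<^sub>i(K, W/U)\<close> sits between \<open>Tor\<^sub>i(K, W/V)\<close> and \<open>Tor\<^sub>i\<^sub>-\<^sub>1(K, U/V)\<close>.\<close>

lemma tor_vanishes_quotient:
  assumes up: "upset n U" "upset n V" "upset n W" and sub: "V \<subseteq> U" "U \<subseteq> W"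
    and WV: "tor_vanishes W V i j" and UV: "i \<noteq> 0 \<Longrightarrow> tor_vanishes U V (i - 1) j"
  shows "tor_vanishes W U i j"
  unfolding tor_vanishes_def
proof (intro ballI impI)
  fix v assume v: "v \<in> ch W i j" and dv: "bdry i v \<in> ch U (i - 1) j"
  have "\<exists>u\<in>ch U i j. bdry i (v - u) \<in> ch V (i - 1) j"
  proof (cases i)
    case 0
    then show ?thesis by (intro bexI[of _ 0]) auto
  next
    case (Suc i')
    have "bdry i' (bdry i v) = 0" using bdry_bdry[OF up(3)] v Suc by blast
    then obtain u where "u \<in> ch U i j" "bdry i v - bdry i u \<in> ch V (i - 1) j"
      using tor_vanishesD[OF UV dv] Suc by auto
    then show ?thesis by (auto simp: differential_minus)
  qed
  then obtain u where u: "u \<in> ch U i j" "bdry i (v - u) \<in> ch V (i - 1) j" by blast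
  have "v - u \<in> ch W i j"
    by (rule monomial_chains_minus[OF v monomial_chains_mono[OF sub(2) u(1)]])
  then obtain w where w: "w \<in> ch W (Suc i) j" "v - u - bdry (Suc i) w \<in> ch V i j"
    using tor_vanishesD[OF WV _ u(2)] by blast
  have "u + (v - u - bdry (Suc i) w) \<in> ch U i j"
    by (rule monomial_chains_add[OF u(1) monomial_chains_mono[OF sub(1) w(2)]])
  then have "v - bdry (Suc i) w \<in> ch U i j" by (simp add: algebra_simps)
  with w show "\<exists>w\<in>ch W (Suc i) j. v - bdry (Suc i) w \<in> ch U i j" by blast
qed

text \<open>For \<open>V \<subseteq> U \<subseteq> W\<close>: \<open>Tor\<^sub>i(K, U/V)\<close> sits between \<open>Tor\<^sub>i\<^sub>+\<^sub>1(K, W/U)\<close> and \<open>Tor\<^sub>i(K, W/V)\<close>.\<close>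

lemma tor_vanishes_sub:
  assumes up: "upset n U" "upset n V" "upset n W" and sub: "V \<subseteq> U" "U \<subseteq> W"
    and WV: "tor_vanishes W V i j" and WU: "tor_vanishes W U (Suc i) j"
  shows "tor_vanishes U V i j"
  unfolding tor_vanishes_def
proof (intro ballI impI)
  fix v assume v: "v \<in> ch U i j" and dv: "bdry i v \<in> ch V (i - 1) j"
  obtain w where w: "w \<in> ch W (Suc i) j" "v - bdry (Suc i) w \<in> ch V i j"
    using tor_vanishesD[OF WV monomial_chains_mono[OF sub(2) v] dv] by blast
  have "v - (v - bdry (Suc i) w) \<in> ch U i j"
    by (rule monomial_chains_minus[OF v monomial_chains_mono[OF sub(1) w(2)]])
  then have "bdry (Suc i) w \<in> ch U (Suc i - 1) j" by simp
  then obtain x where x: "x \<in> ch W (Suc (Suc i)) j" "w - bdry (Suc (Suc i)) x \<in> ch U (Suc i) j"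
    using tor_vanishesD[OF WU w(1)] by blast
  have "bdry (Suc i) (w - bdry (Suc (Suc i)) x) = bdry (Suc i) w"
    using bdry_bdry[OF up(3) x(1)] by (simp add: differential_minus)
  with x w show "\<exists>w\<in>ch U (Suc i) j. v - bdry (Suc i) w \<in> ch V i j" by metis
qed

text \<open>Multiplication by a monomial is an isomorphism.\<close>

lemma tor_vanishes_shift:
  assumes "tor_vanishes U V i j" and j': "j' = j + int (mon_degree g)"
  shows "tor_vanishes ((+) g ` U) ((+) g ` V) i j'"
  unfolding tor_vanishes_def j'
proof (intro ballI impI)
  fix v assume "v \<in> ch ((+) g ` U) i (j + int (mon_degree g))"
    and dv: "bdry i v \<in> ch ((+) g ` V) (i - 1) (j + int (mon_degree g))"
  then obtain u where u: "u \<in> ch U i j" and v: "v = (\<lambda>k. single g 1 * u k)"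
    using divide_monomial_chains by blast
  have "bdry i u \<in> ch V (i - 1) j"
    using dv unfolding v differential_mult monomial_chains_times_iff .
  then obtain w where w: "w \<in> ch U (Suc i) j" "u - bdry (Suc i) w \<in> ch V i j"
    using tor_vanishesD[OF assms(1) u] by blast
  let ?w = "\<lambda>k. single g 1 * w k"
  have eq: "v - bdry (Suc i) ?w = (\<lambda>k. single g 1 * (u - bdry (Suc i) w) k)"
    by (simp add: v differential_mult fun_eq_iff right_diff_distrib)
  show "\<exists>w\<in>ch ((+) g ` U) (Suc i) (j + int (mon_degree g)).
      v - bdry (Suc i) w \<in> ch ((+) g ` V) i (j + int (mon_degree g))"
    by (rule bexI[of _ ?w]) (use w in \<open>auto simp only: eq monomial_chains_times_iff\<close>)
qed

text \<open>The isomorphism \<open>A/(A \<inter> B) \<cong> (A + B)/B\<close>.\<close>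

lemma tor_vanishes_Un:
  assumes up: "upset n A" "upset n B" and v: "tor_vanishes A (A \<inter> B) i j"
  shows "tor_vanishes (A \<union> B) B i j"
  unfolding tor_vanishes_def
proof (intro ballI impI)
  fix v assume v: "v \<in> ch (A \<union> B) i j" and dv: "bdry i v \<in> ch B (i - 1) j"
  obtain a b where ab: "v = a + b" "a \<in> ch A i j" "b \<in> ch B i j"
    using split_monomial_chains[OF v] by blast
  have "bdry i a = bdry i v - bdry i b" using ab by (simp add: differential_add)
  moreover have "bdry i v - bdry i b \<in> ch B (i - 1) j"
    by (rule monomial_chains_minus[OF dv bdry_chains[OF up(2) ab(3)]])
  ultimately have "bdry i a \<in> ch (A \<inter> B) (i - 1) j"
    using monomial_chains_Int bdry_chains[OF up(1) ab(2)] by metis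
  then obtain w where w: "w \<in> ch A (Suc i) j" "a - bdry (Suc i) w \<in> ch (A \<inter> B) i j"
    using tor_vanishesD[OF assms(3) ab(2)] by blast
  have "b + (a - bdry (Suc i) w) \<in> ch B i j"
    by (rule monomial_chains_add[OF ab(3) monomial_chains_mono[OF Int_lower2 w(2)]])
  then have "v - bdry (Suc i) w \<in> ch B i j" by (simp add: ab algebra_simps)
  moreover have "w \<in> ch (A \<union> B) (Suc i) j" by (rule monomial_chains_mono[OF Un_upper1 w(1)])
  ultimately show "\<exists>w\<in>ch (A \<union> B) (Suc i) j. v - bdry (Suc i) w \<in> ch B i j" by blast
qed

text \<open>For an ideal \<open>I\<close> and a monomial \<open>x\<^sup>g\<close> of degree \<open>t\<close>, multiplication by \<open>x\<^sup>g\<close> identifies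
  \<open>(S/(I : x\<^sup>g))(-t)\<close> with \<open>(I + (x\<^sup>g))/I\<close>.\<close>

lemma tor_vanishes_add_monomial:
  assumes "g \<in> exponents n" "upset n U" "upset n V"
    and colon: "(+) g ` exponents n \<inter> U = (+) g ` V"
    and "tor_vanishes (exponents n) V i (j - int (mon_degree g))"
  shows "tor_vanishes ((+) g ` exponents n \<union> U) U i j"
proof (rule tor_vanishes_Un)
  show "tor_vanishes ((+) g ` exponents n) ((+) g ` exponents n \<inter> U) i j"
    unfolding colon by (rule tor_vanishes_shift[OF assms(5)]) simp
qed (use assms upset_shift upset_exponents in auto)

text \<open>\<open>S\<close> modulo a set of variables has a linear resolution.\<close>

lemma tor_vanishes_variables:
  assumes "finite W" "W \<subseteq> {1..n}" "int i \<noteq> j"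
  shows "tor_vanishes (exponents n) (generated n ((\<lambda>w. single w 1) ` W)) i j"
  using assms
proof (induction W arbitrary: i j rule: finite_induct)
  case empty
  have "generated n {} = {}" by (simp add: generated_def)
  then show ?case using empty tor_vanishes_exponents[of i j] by (cases "i = 0") auto
next
  case (insert x W)
  let ?G = "(\<lambda>w. single w (1::nat)) ` W"
  let ?g = "single x (1::nat)"
  have g: "?g \<in> exponents n" using insert by (auto simp: exponents_def)
  have "single w 1 - ?g = single w 1" if "w \<in> W" for w
    using that insert.hyps by (intro poly_mapping_eqI) (auto simp: lookup_minus lookup_single when_def)
  then have "(\<lambda>h. h - ?g) ` ?G = ?G" by (auto simp: image_image)
  then have colon: "(+) ?g ` exponents n \<inter> generated n ?G = (+) ?g ` generated n ?G"
    using generated_colon[OF g, of ?G] by simp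
  have ins: "generated n ((\<lambda>w. single w 1) ` insert x W) = (+) ?g ` exponents n \<union> generated n ?G"
    using generated_insert[OF g] by simp
  have sub: "(+) ?g ` exponents n \<union> generated n ?G \<subseteq> exponents n"
    using g by (auto simp: exponents_add_iff generated_def)
  show ?case unfolding ins
  proof (rule tor_vanishes_quotient[where V = "generated n ?G"])
    show "tor_vanishes (exponents n) (generated n ?G) i j" using insert by simp
    show "tor_vanishes ((+) ?g ` exponents n \<union> generated n ?G) (generated n ?G) (i - 1) j" if "i \<noteq> 0"
      by (rule tor_vanishes_add_monomial[OF g upset_generated upset_generated colon], rule insert.IH)
        (use that insert.prems in auto)
  qed (use g sub in \<open>auto intro!: upset_Un upset_shift upset_exponents upset_generated\<close>)
qed

text \<open>Taylor's bound: \<open>S\<close> modulo \<open>r\<close> monomials has projective dimension at most \<open>r\<close>.\<close>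

lemma tor_vanishes_Taylor:
  assumes "finite G" "G \<subseteq> exponents n" "card G \<le> r" "r < i"
  shows "tor_vanishes (exponents n) (generated n G) i j"
  using assms
proof (induction r arbitrary: G i j)
  case 0
  then have "generated n G = {}" by (auto simp: generated_def)
  then show ?case using 0 tor_vanishes_exponents by auto
next
  case (Suc r G i j)
  show ?case
  proof (cases "G = {}")
    case True
    then have "generated n G = {}" by (auto simp: generated_def)
    then show ?thesis using Suc.prems tor_vanishes_exponents by auto
  next
    case False
    then obtain g G' where G': "G = insert g G'" "g \<notin> G'" by (metis all_not_in_conv mk_disjoint_insert)
    have fin: "finite G'" "G' \<subseteq> exponents n" "card G' \<le> r" and g: "g \<in> exponents n"
      using Suc.prems G' by auto
    let ?C = "(\<lambda>h. h - g) ` G'"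
    have "h - g \<in> exponents n" if "h \<in> exponents n" for h
      using that by (auto simp: exponents_def in_keys_iff lookup_minus subset_iff)
    then have C: "?C \<subseteq> exponents n" "finite ?C" "card ?C \<le> r"
      using fin card_image_le[of G' "\<lambda>h. h - g"] by auto
    have sub: "(+) g ` exponents n \<union> generated n G' \<subseteq> exponents n"
      using g by (auto simp: exponents_add_iff generated_def)
    have "tor_vanishes (exponents n) ((+) g ` exponents n \<union> generated n G') i j"
    proof (rule tor_vanishes_quotient[where V = "generated n G'"])
      show "tor_vanishes (exponents n) (generated n G') i j"
        using fin Suc.prems by (intro Suc.IH) auto
      show "tor_vanishes ((+) g ` exponents n \<union> generated n G') (generated n G') (i - 1) j"
        using C Suc.prems
        by (intro tor_vanishes_add_monomial[OF g _ _ generated_colon[OF g]] upset_generated Suc.IH) auto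
    qed (use g sub in \<open>auto intro!: upset_Un upset_shift upset_exponents upset_generated\<close>)
    then show ?thesis unfolding G'(1) generated_insert[OF g] .
  qed
qed

end

section \<open>Dimensions\<close>

context vector_space
begin

lemma finite_basis_in_span:
  assumes "finite E" "S \<subseteq> span E" "B \<subseteq> S" "independent B"
  obtains C where "B \<subseteq> C" "C \<subseteq> S" "independent C" "S \<subseteq> span C" "finite C" "dim S = card C"
proof -
  obtain C where C: "B \<subseteq> C" "C \<subseteq> S" "independent C" "S \<subseteq> span C"
    using maximal_independent_subset_extend[OF assms(3,4)] by blast
  have "finite C" using independent_span_bound[OF assms(1) C(3)] C(2) assms(2) by blast
  moreover have "dim S = card C" using basis_card_eq_dim[OF C(2,4,3)] by simp
  ultimately show thesis using C that by blast
qed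

text \<open>The inclusions \<open>Z \<subseteq> Z'\<close> and \<open>B \<subseteq> B'\<close> induce a map \<open>Z/B \<rightarrow> Z'/B'\<close>. If it is injective,
  then \<open>dim (Z/B) \<le> dim (Z'/B')\<close>, with equality if it is also surjective.\<close>

lemma dim_quotient_mono:
  assumes E: "finite E" "Z' \<subseteq> span E"
    and sub: "subspace Z" "subspace B'" "B \<subseteq> Z" "Z \<subseteq> Z'" "B \<subseteq> B'" "B' \<subseteq> Z'"
    and inj: "Z \<inter> B' \<subseteq> B"
  shows "dim Z - dim B \<le> dim Z' - dim B'"
    and "Z' \<subseteq> {x + y |x y. x \<in> Z \<and> y \<in> B'} \<Longrightarrow> dim Z - dim B = dim Z' - dim B'"
proof -
  have spans: "B \<subseteq> span E" "Z \<subseteq> span E" "B' \<subseteq> span E" using E sub by blast+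
  obtain b where "{} \<subseteq> b" and b: "b \<subseteq> B" "independent b" "B \<subseteq> span b" "finite b" "dim B = card b"
    by (rule finite_basis_in_span[OF E(1) spans(1) empty_subsetI independent_empty])
  obtain z where z: "b \<subseteq> z" "z \<subseteq> Z" "independent z" "Z \<subseteq> span z" "finite z" "dim Z = card z"
    by (rule finite_basis_in_span[OF E(1) spans(2) order_trans[OF b(1) sub(3)] b(2)])
  obtain c where c: "b \<subseteq> c" "c \<subseteq> B'" "independent c" "B' \<subseteq> span c" "finite c" "dim B' = card c"
    by (rule finite_basis_in_span[OF E(1) spans(3) order_trans[OF b(1) sub(5)] b(2)])
  \<comment> \<open>The vectors that extend the basis \<open>b\<close> of \<open>B\<close> to a basis of \<open>Z\<close> are independent modulo \<open>B'\<close>.\<close>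
  have ind: "independent (P \<union> c) \<and> P \<inter> c = {}" if "P \<subseteq> z - b" for P
  proof -
    have "finite P" using that z by (meson finite_Diff finite_subset)
    then show ?thesis using that
    proof (induction P rule: finite_induct)
      case (insert p P)
      have "p \<notin> span (P \<union> c)"
      proof
        assume "p \<in> span (P \<union> c)"
        then obtain x y where xy: "p = x + y" "x \<in> span P" "y \<in> span c"
          unfolding span_Un by blast
        have "y \<in> B'" using xy(3) span_minimal[OF c(2) sub(2)] by blast
        moreover have "span P \<subseteq> Z" using insert.prems z(2) by (intro span_minimal sub(1)) auto
        then have "p - x \<in> Z" using xy(2) insert.prems z(2) by (intro subspace_diff[OF sub(1)]) auto
        then have "y \<in> Z" using xy(1) by simp
        ultimately have "y \<in> span b" using inj b(3) by blast
        then have "p \<in> span (P \<union> b)" using xy unfolding span_Un by blast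
        moreover have "independent (insert p (P \<union> b))"
          using insert.prems z(1) by (intro independent_mono[OF z(3)]) auto
        ultimately show False
          using insert.prems insert.hyps by (auto simp: independent_insert)
      qed
      moreover have "p \<notin> c" using calculation span_base by blast
      ultimately show ?case using insert by (auto simp: independent_insert)
    qed (use c in auto)
  qed
  let ?P = "z - b"
  have card: "card (?P \<union> c) = (card z - card b) + card c"
    using ind[of ?P] z c b by (simp add: card_Un_disjoint card_Diff_subset)
  have le: "card b \<le> card z" using z by (simp add: card_mono)
  have subZ': "?P \<union> c \<subseteq> Z'" using z c sub by blast
  have "card (?P \<union> c) \<le> dim Z'"
  proof -
    obtain w where "?P \<union> c \<subseteq> w" "w \<subseteq> Z'" "independent w" "Z' \<subseteq> span w" "finite w" "dim Z' = card w"
      by (rule finite_basis_in_span[OF E subZ' conjunct1[OF ind[OF order_refl]]])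
    then show ?thesis by (simp add: card_mono)
  qed
  then show "dim Z - dim B \<le> dim Z' - dim B'"
    using card le by (simp add: z b c)
  assume surj: "Z' \<subseteq> {x + y |x y. x \<in> Z \<and> y \<in> B'}"
  have "Z \<subseteq> span (?P \<union> c)"
    using z(4) c(1) span_mono[of z "?P \<union> c"] by blast
  moreover have "B' \<subseteq> span (?P \<union> c)" using c(4) span_mono[of c "?P \<union> c"] by blast
  ultimately have "Z' \<subseteq> span (?P \<union> c)"
    using surj span_add by blast
  then have "dim Z' \<le> card (?P \<union> c)"
    using z c by (intro dim_le_card) auto
  then show "dim Z - dim B = dim Z' - dim B'"
    using \<open>card (?P \<union> c) \<le> dim Z'\<close> card le by (simp add: z b c)
qed

lemma dim_quotient_pos:
  assumes "finite E" "Z \<subseteq> span E" "subspace B" "B \<subseteq> Z" "v \<in> Z" "v \<notin> B"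
  shows "dim Z - dim B > 0"
proof -
  obtain b where "{} \<subseteq> b" and b: "b \<subseteq> B" "independent b" "B \<subseteq> span b" "finite b" "dim B = card b"
    by (rule finite_basis_in_span[OF assms(1) order_trans[OF assms(4,2)] empty_subsetI independent_empty])
  have "v \<notin> span b" using span_minimal[OF b(1) assms(3)] assms(6) by blast
  then have ind: "independent (insert v b)" "v \<notin> b"
    using b span_base by (auto simp: independent_insert)
  have "insert v b \<subseteq> Z" using b assms by blast
  then obtain w where "insert v b \<subseteq> w" "w \<subseteq> Z" "independent w" "Z \<subseteq> span w" "finite w" "dim Z = card w"
    by (rule finite_basis_in_span[OF assms(1,2) _ ind(1)])
  then have "card (insert v b) \<le> dim Z" by (simp add: card_mono)
  then show ?thesis using b ind by simp
qed

end

text \<open>The scalar multiplication with respect to which the dimensions of Tor are taken.\<close>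

abbreviation family_scale :: "'k::field \<Rightarrow> (nat \<Rightarrow> 'k mpoly) \<Rightarrow> (nat \<Rightarrow> 'k mpoly)" where
  "family_scale c v \<equiv> (\<lambda>k. const c * v k)"

interpretation family: vector_space family_scale
  by unfold_locales (auto simp: fun_eq_iff const_def algebra_simps single_add mult_single
      simp flip: single_one)

lemma const_times_keys: "keys (const c * p) \<subseteq> keys (p :: 'k::field mpoly)"
  using keys_mult[of "const c" p] keys_const[of c] by fastforce

lemma const_times_chains:
  "v \<in> monomial_chains F U i j \<Longrightarrow> family_scale c v \<in> monomial_chains F U i j"
  using const_times_keys by (fastforce simp: monomial_chains_def)

lemma subspace_monomial_chains: "family.subspace (monomial_chains F U i j)"
  by (auto simp: family.subspace_def monomial_chains_add const_times_chains)

lemma monomial_chains_finite_dimensional: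
  fixes F :: "'k::field free_complex"
  assumes "U \<subseteq> exponents n"
  obtains E where "finite E" "monomial_chains F U i j \<subseteq> family.span E"
proof -
  let ?M = "\<lambda>k. {m \<in> exponents n. int (mon_degree m) = j - shift F i k}"
  let ?unit = "\<lambda>k m. (\<lambda>k'. if k' = k then single m (1::'k) else 0)"
  let ?E = "\<Union>k\<in>{..<rk F i}. ?unit k ` ?M k"
  have "finite (?M k)" for k
    by (rule finite_subset[OF _ finite_exponents_degree[of n "nat (j - shift F i k)"]]) auto
  then have fin: "finite ?E" by blast
  have "v \<in> family.span ?E" if v: "v \<in> monomial_chains F U i j" for v
  proof -
    have "v = (\<Sum>k<rk F i. \<Sum>m\<in>keys (v k). family_scale (lookup (v k) m) (?unit k m))"
    proof
      fix k'
      have app: "(sum f A) x = (\<Sum>a\<in>A. f a x)" for f :: "'z \<Rightarrow> nat \<Rightarrow> 'k mpoly" and A x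
        by (induction A rule: infinite_finite_induct) auto
      have "(\<Sum>k<rk F i. \<Sum>m\<in>keys (v k). family_scale (lookup (v k) m) (?unit k m)) k'
          = (\<Sum>k<rk F i. if k' = k then (\<Sum>m\<in>keys (v k). single m (lookup (v k) m)) else 0)"
        unfolding app by (intro sum.cong refl) (auto simp: const_def mult_single)
      also have "\<dots> = v k'"
        using v by (auto simp: sum_single_keys sum.delta monomial_chains_def)
      finally show "v k' = (\<Sum>k<rk F i. \<Sum>m\<in>keys (v k). family_scale (lookup (v k) m) (?unit k m)) k'"
        by simp
    qed
    also have "\<dots> \<in> family.span ?E"
    proof (intro family.span_sum family.span_scale family.span_base)
      fix k m assume "k \<in> {..<rk F i}" "m \<in> keys (v k)"
      then show "?unit k m \<in> ?E"
        using v assms unfolding monomial_chains_def by blast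
    qed
    finally show ?thesis .
  qed
  then show thesis using that fin by blast
qed

section \<open>Comparison of Betti numbers along an inclusion of ideals\<close>

context residue_resolution
begin

abbreviation cyc where "cyc U i j \<equiv> {v \<in> ch U i j. bdry i v = 0}"
abbreviation bnd where "bnd U i j \<equiv> bdry (Suc i) ` ch U (Suc i) j"

text \<open>\<open>dim Tor\<^sub>i(K, I)\<^sub>j\<close> for the ideal \<open>I\<close> spanned by the monomials in \<open>U\<close>.\<close>

definition tor_dimension :: "(nat \<Rightarrow>\<^sub>0 nat) set \<Rightarrow> nat \<Rightarrow> int \<Rightarrow> nat" where
  "tor_dimension U i j = family.dim (cyc U i j) - family.dim (bnd U i j)"

lemma subspace_cyc: "family.subspace (cyc U i j)"
proof -
  have "bdry i (family_scale c v) = 0" if "bdry i v = 0" for c v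
    using differential_mult[of F i "const c" v] that by (simp add: fun_eq_iff)
  then show ?thesis
    using subspace_monomial_chains[of F U i j] by (auto simp: family.subspace_def differential_add)
qed

lemma subspace_bnd: "family.subspace (bnd U i j)"
proof (rule family.subspaceI)
  show "0 \<in> bnd U i j" by (rule image_eqI[of _ _ 0]) auto
  fix x y assume "x \<in> bnd U i j" "y \<in> bnd U i j"
  then show "x + y \<in> bnd U i j"
    by (auto simp flip: differential_add intro: monomial_chains_add)
next
  fix c x assume "x \<in> bnd U i j"
  then obtain v where v: "v \<in> ch U (Suc i) j" "x = bdry (Suc i) v" by blast
  then show "family_scale c x \<in> bnd U i j"
    by (intro image_eqI[of _ _ "family_scale c v"]) (auto simp: differential_mult intro: const_times_chains)
qed

lemma bnd_subset_cyc: "upset n U \<Longrightarrow> bnd U i j \<subseteq> cyc U i j"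
  using bdry_bdry bdry_Suc_chains by blast

lemma cyc_finite_dimensional:
  assumes "upset n U"
  obtains E where "finite E" "cyc U i j \<subseteq> family.span E"
proof -
  obtain E where "finite E" "ch U i j \<subseteq> family.span E"
    using monomial_chains_finite_dimensional[of U n F i j] assms by (auto simp: upset_def)
  then show thesis using that by blast
qed

lemma tor_dimension_mono:
  assumes up: "upset n U" "upset n V" and sub: "U \<subseteq> V"
    and inj: "cyc U i j \<inter> bnd V i j \<subseteq> bnd U i j"
  shows "tor_dimension U i j \<le> tor_dimension V i j"
    and "tor_vanishes V U i j \<Longrightarrow> tor_dimension U i j = tor_dimension V i j"
proof -
  obtain E where E: "finite E" "cyc V i j \<subseteq> family.span E"
    using cyc_finite_dimensional[OF up(2)] by blast
  have ch: "ch U k j \<subseteq> ch V k j" for k using monomial_chains_mono[OF sub] by blast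
  then have subs: "cyc U i j \<subseteq> cyc V i j" "bnd U i j \<subseteq> bnd V i j" by blast+
  note * = family.dim_quotient_mono[OF E subspace_cyc subspace_bnd
      bnd_subset_cyc[OF up(1)] subs bnd_subset_cyc[OF up(2)] inj]
  show "tor_dimension U i j \<le> tor_dimension V i j"
    unfolding tor_dimension_def by (rule *(1))
  assume van: "tor_vanishes V U i j"
  have "cyc V i j \<subseteq> {x + y |x y. x \<in> cyc U i j \<and> y \<in> bnd V i j}"
  proof
    fix v assume v: "v \<in> cyc V i j"
    then obtain w where w: "w \<in> ch V (Suc i) j" "v - bdry (Suc i) w \<in> ch U i j"
      using tor_vanishesD[OF van, of v] by auto
    have "bdry i (v - bdry (Suc i) w) = 0"
      using v bdry_bdry[OF up(2) w(1)] by (simp add: differential_minus)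
    then show "v \<in> {x + y |x y. x \<in> cyc U i j \<and> y \<in> bnd V i j}"
      using w by (intro CollectI exI[of _ "v - bdry (Suc i) w"] exI[of _ "bdry (Suc i) w"]) auto
  qed
  then show "tor_dimension U i j = tor_dimension V i j"
    unfolding tor_dimension_def by (rule *(2))
qed

text \<open>Injectivity of \<open>Tor\<^sub>i(K, I)\<^sub>j \<rightarrow> Tor\<^sub>i(K, I')\<^sub>j\<close> from the long exact sequence of \<open>I \<subseteq> I'\<close>.\<close>

lemma bnd_Int_cyc_subset:
  assumes "upset n U" "upset n V" "U \<subseteq> V" "tor_vanishes V U (Suc i) j"
  shows "cyc U i j \<inter> bnd V i j \<subseteq> bnd U i j"
proof
  fix z assume z: "z \<in> cyc U i j \<inter> bnd V i j"
  then obtain w where w: "w \<in> ch V (Suc i) j" "z = bdry (Suc i) w" by blast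
  then have "bdry (Suc i) w \<in> ch U (Suc i - 1) j" using z by simp
  then obtain x where x: "x \<in> ch V (Suc (Suc i)) j" "w - bdry (Suc (Suc i)) x \<in> ch U (Suc i) j"
    using tor_vanishesD[OF assms(4) w(1)] by blast
  have "bdry (Suc i) (w - bdry (Suc (Suc i)) x) = z"
    using bdry_bdry[OF assms(2) x(1)] w by (simp add: differential_minus)
  with x show "z \<in> bnd U i j" by blast
qed

lemma tor_dimension_eq_0:
  assumes "upset n U" "tor_vanishes U {} i j"
  shows "tor_dimension U i j = 0"
proof -
  have "cyc U i j \<subseteq> bnd U i j"
  proof
    fix v assume v: "v \<in> cyc U i j"
    then obtain w where "w \<in> ch U (Suc i) j" "v - bdry (Suc i) w = 0"
      using tor_vanishesD[OF assms(2), of v] by (auto simp: monomial_chains_empty)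
    then show "v \<in> bnd U i j" by auto
  qed
  then have "cyc U i j = bnd U i j" using bnd_subset_cyc[OF assms(1)] by blast
  then show ?thesis by (simp add: tor_dimension_def)
qed

text \<open>The heart of the proof. Let \<open>x\<^sup>f = x\<^sup>\<epsilon> x\<^sub>c\<close> be a monomial of degree \<open>r\<close> with
  \<open>I : x\<^sup>f = (W)\<close> for a set \<open>W\<close> of variables, and suppose that \<open>x\<^sup>\<epsilon> (W) \<subseteq> I\<close>. Adding \<open>x\<^sup>f\<close> to \<open>I\<close>
  changes the Betti numbers only in the strand \<open>j = i + r\<close>, where they can only grow. The quotient
  \<open>(I + (x\<^sup>f))/I\<close> is \<open>(S/(W))(-r)\<close>, which has a linear resolution; hence the only connecting maps
  that could be nonzero end in \<open>Tor\<^sub>i(K, I)\<^sub>j\<close> with \<open>j = i + 1 + r\<close>. They factor through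
  \<open>Tor\<^sub>i(K, x\<^sup>\<epsilon> (W))\<^sub>j\<close>, which vanishes because \<open>(W)\<close> has a linear resolution as well.\<close>

lemma tor_dimension_add_monomial:
  assumes W: "W \<subseteq> {1..n}" and \<epsilon>: "\<epsilon> \<in> exponents n" and c: "c \<in> {1..n}"
    and U: "upset n U" and f: "f = \<epsilon> + single c 1" and r: "mon_degree f = r"
    and colon: "(+) f ` exponents n \<inter> U = (+) f ` generated n ((\<lambda>w. single w 1) ` W)"
    and lower: "(+) \<epsilon> ` generated n ((\<lambda>w. single w 1) ` W) \<subseteq> U"
  shows "j \<noteq> int i + int r \<Longrightarrow>
      tor_dimension U i j = tor_dimension ((+) f ` exponents n \<union> U) i j"
    and "tor_dimension U i j \<le> tor_dimension ((+) f ` exponents n \<union> U) i j"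
proof -
  let ?G = "generated n ((\<lambda>w. single w (1::nat)) ` W)"
  let ?M = "(+) f ` exponents n"
  let ?V = "?M \<union> U"
  have finW: "finite W" using W by (rule finite_subset) simp
  have c': "single c 1 \<in> exponents n" using c by (simp add: exponents_def)
  have f': "f \<in> exponents n" using \<epsilon> c' by (simp add: f exponents_add_iff)
  have M: "upset n ?M" by (rule upset_shift[OF f' upset_exponents])
  then have V: "upset n ?V" using U by (rule upset_Un)
  have sub: "U \<subseteq> ?V" by blast
  have van: "tor_vanishes ?V U i j" if "j \<noteq> int i + int r" for i
    using that r
    by (intro tor_vanishes_add_monomial[OF f' U upset_generated colon] tor_vanishes_variables finW W) auto
  have "cyc U i j \<inter> bnd ?V i j \<subseteq> bnd U i j"
  proof (cases "j = int i + 1 + int r")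
    case False
    then show ?thesis by (intro bnd_Int_cyc_subset U V sub van) auto
  next
    case True
    have deg: "int r = int (mon_degree \<epsilon>) + 1" using r by (simp add: f mon_degree_add)
    have "tor_vanishes ?G {} i (int i + 2)"
      by (rule tor_vanishes_sub[OF upset_generated upset_empty upset_exponents empty_subsetI
            generated_subset_exponents tor_vanishes_exponents tor_vanishes_variables[OF finW W]]) auto
    from tor_vanishes_shift[OF this, of j \<epsilon>]
    have van\<epsilon>: "tor_vanishes ((+) \<epsilon> ` ?G) {} i j" using True deg by simp
    show ?thesis
    proof
      fix z assume z: "z \<in> cyc U i j \<inter> bnd ?V i j"
      then obtain w where w: "w \<in> ch ?V (Suc i) j" "z = bdry (Suc i) w" by blast
      \<comment> \<open>The part \<open>a\<close> of \<open>w\<close> divisible by \<open>x\<^sup>f\<close> is replaced by a chain with coefficients in \<open>x\<^sup>\<epsilon> (W)\<close>.\<close>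
      obtain a b where ab: "w = a + b" "a \<in> ch ?M (Suc i) j" "b \<in> ch U (Suc i) j"
        using split_monomial_chains[OF w(1)] by blast
      have eq: "bdry (Suc i) a = z - bdry (Suc i) b" using w ab by (simp add: differential_add)
      have "z - bdry (Suc i) b \<in> ch U i j"
        using z by (intro monomial_chains_minus bdry_Suc_chains[OF U ab(3)]) auto
      then have "bdry (Suc i) a \<in> ch (?M \<inter> U) i j"
        using monomial_chains_Int bdry_Suc_chains[OF M ab(2)] eq by metis
      moreover have "?M \<inter> U \<subseteq> (+) \<epsilon> ` ?G"
      proof
        fix m assume "m \<in> ?M \<inter> U"
        then obtain g where g: "g \<in> ?G" "m = f + g" unfolding colon by blast
        have "single c 1 + g \<in> ?G" using upset_generated g(1) c' unfolding upset_def by blast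
        then show "m \<in> (+) \<epsilon> ` ?G"
          by (rule image_eqI[rotated]) (simp add: g f add.assoc)
      qed
      ultimately have a: "bdry (Suc i) a \<in> ch ((+) \<epsilon> ` ?G) i j"
        using monomial_chains_mono by blast
      moreover have "bdry i (bdry (Suc i) a) = 0" using bdry_bdry[OF M ab(2)] .
      ultimately obtain x where x: "x \<in> ch ((+) \<epsilon> ` ?G) (Suc i) j" "bdry (Suc i) a - bdry (Suc i) x = 0"
        using tor_vanishesD[OF van\<epsilon> a] by (auto simp: monomial_chains_empty)
      have "z = bdry (Suc i) (b + x)"
        using x(2) eq by (simp add: differential_add algebra_simps)
      moreover have "b + x \<in> ch U (Suc i) j"
        by (rule monomial_chains_add[OF ab(3) monomial_chains_mono[OF lower x(1)]])
      ultimately show "z \<in> bnd U i j" by blast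
    qed
  qed
  then show "tor_dimension U i j \<le> tor_dimension ?V i j"
    and "j \<noteq> int i + int r \<Longrightarrow> tor_dimension U i j = tor_dimension ?V i j"
    using tor_dimension_mono[OF U V sub] van by blast+
qed

text \<open>A monomial ideal with \<open>r\<close> generators has projective dimension at most \<open>r\<close>.\<close>

lemma tor_dimension_Taylor:
  assumes "finite G" "G \<subseteq> exponents n" "card G < i"
  shows "tor_dimension (generated n G) i j = 0"
proof (rule tor_dimension_eq_0[OF upset_generated])
  show "tor_vanishes (generated n G) {} i j"
  proof (rule tor_vanishes_sub[where W = "exponents n"])
    show "tor_vanishes (exponents n) (generated n G) (Suc i) j"
      using assms by (intro tor_vanishes_Taylor[where r = "card G"]) auto
    show "tor_vanishes (exponents n) {} i j" using assms by (intro tor_vanishes_exponents) auto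
  qed (rule upset_generated upset_empty upset_exponents empty_subsetI generated_subset_exponents)+
qed

end

section \<open>Existence of a resolution of the residue field\<close>

text \<open>The mapping cone of multiplication by \<open>X\<close>, a form of degree 1, on the complex \<open>F\<close>:
  $G_{i+1} = F_{i+1} \oplus F_i(-1)$ with differential \<open>(a, b) \<mapsto> (\<partial>a + X b, - \<partial>b)\<close>. The basis of
  \<open>F\<^sub>i\<^sub>+\<^sub>1\<close> comes first.\<close>

definition cone :: "'k::field free_complex \<Rightarrow> 'k mpoly \<Rightarrow> 'k free_complex" where
  "cone F X = \<lparr>
    rk = (\<lambda>i. rk F i + (case i of 0 \<Rightarrow> 0 | Suc i' \<Rightarrow> rk F i')),
    shift = (\<lambda>i k. if k < rk F i then shift F i k else shift F (i - 1) (k - rk F i) + 1),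
    dmat = (\<lambda>i k l.
      if k < rk F i
      then (if l < rk F (Suc i) then dmat F i k l else if l - rk F (Suc i) = k then X else 0)
      else (if l < rk F (Suc i) then 0 else - dmat F (i - 1) (k - rk F i) (l - rk F (Suc i))))\<rparr>"

text \<open>The pair \<open>(a, b)\<close> with \<open>a \<in> F\<^sub>i\<close>, written as one coefficient family of the cone.\<close>

definition join :: "'k::field free_complex \<Rightarrow> nat \<Rightarrow> (nat \<Rightarrow> 'k mpoly) \<Rightarrow> (nat \<Rightarrow> 'k mpoly) \<Rightarrow> (nat \<Rightarrow> 'k mpoly)" where
  "join F i a b = (\<lambda>k. if k < rk F i then a k else b (k - rk F i))"

lemma sum_lessThan_add:
  fixes a b :: nat
  shows "(\<Sum>l<a + b. f l) = (\<Sum>l<a. f l) + (\<Sum>l<b. f (a + l) :: 'a::comm_monoid_add)"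
  by (induction b) (auto simp: ac_simps)

lemma cone_rk_0 [simp]: "rk (cone F X) 0 = rk F 0"
  by (simp add: cone_def)

lemma cone_rk_Suc [simp]: "rk (cone F X) (Suc i) = rk F (Suc i) + rk F i"
  by (simp add: cone_def)

lemma cone_chains_0: "monomial_chains (cone F X) U 0 j = monomial_chains F U 0 j"
  by (auto simp: monomial_chains_def cone_def)

lemma join_chains:
  assumes "a \<in> monomial_chains F U (Suc i) j" "b \<in> monomial_chains F U i (j - 1)"
  shows "join F (Suc i) a b \<in> monomial_chains (cone F X) U (Suc i) j"
proof -
  have "keys (join F (Suc i) a b k) \<subseteq> {m \<in> U. int (mon_degree m) = j - shift (cone F X) (Suc i) k}"
    if "k < rk F (Suc i) + rk F i" for k
  proof (cases "k < rk F (Suc i)")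
    case True
    then show ?thesis using assms by (auto simp: monomial_chains_def join_def cone_def)
  next
    case False
    then have "k - rk F (Suc i) < rk F i" using that by auto
    then show ?thesis using assms False by (fastforce simp: monomial_chains_def join_def cone_def)
  qed
  then show ?thesis using assms by (auto simp: monomial_chains_def join_def)
qed

lemma cone_chains_Suc:
  assumes "v \<in> monomial_chains (cone F X) U (Suc i) j"
  obtains a b where "v = join F (Suc i) a b"
    "a \<in> monomial_chains F U (Suc i) j" "b \<in> monomial_chains F U i (j - 1)"
proof -
  let ?r = "rk F (Suc i)"
  let ?a = "\<lambda>k. if k < ?r then v k else 0" and ?b = "\<lambda>k. v (?r + k)"
  have v: "keys (v k) \<subseteq> {m \<in> U. int (mon_degree m) = j - shift (cone F X) (Suc i) k}"
    if "k < ?r + rk F i" for k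
    using assms that by (simp add: monomial_chains_def)
  have "v = join F (Suc i) ?a ?b" by (auto simp: join_def fun_eq_iff)
  moreover have "?a \<in> monomial_chains F U (Suc i) j"
  proof -
    have "keys (v k) \<subseteq> {m \<in> U. int (mon_degree m) = j - shift F (Suc i) k}" if "k < ?r" for k
      using v[of k] that by (simp add: cone_def)
    then show ?thesis by (simp add: monomial_chains_def)
  qed
  moreover have "?b \<in> monomial_chains F U i (j - 1)"
  proof -
    have "keys (?b k) \<subseteq> {m \<in> U. int (mon_degree m) = j - 1 - shift F i k}" if "k < rk F i" for k
      using v[of "?r + k"] that by (auto simp: cone_def)
    then show ?thesis using assms by (simp add: monomial_chains_def)
  qed
  ultimately show thesis by (rule that)
qed

lemma join_inject:
  assumes "a \<in> monomial_chains F U i j" "a' \<in> monomial_chains F U i j" "join F i a b = join F i a' b'"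
  shows "a = a'" "b = b'"
proof
  fix k show "a k = a' k"
  proof (cases "k < rk F i")
    case True
    then show ?thesis using fun_cong[OF assms(3), of k] by (simp add: join_def)
  qed (use assms(1,2) in \<open>simp add: monomial_chains_def\<close>)
next
  show "b = b'"
  proof
    fix k show "b k = b' k"
      using fun_cong[OF assms(3), of "rk F i + k"] by (simp add: join_def)
  qed
qed

lemma cone_differential_1:
  assumes "b \<in> monomial_chains F U 0 j'"
  shows "differential (cone F X) (Suc 0) (join F (Suc 0) a b) = differential F (Suc 0) a + (\<lambda>k. X * b k)"
proof
  fix k
  have b0: "b k = 0" if "\<not> k < rk F 0" using assms that by (simp add: monomial_chains_def)
  have "(\<Sum>l<rk F (Suc 0) + rk F 0. dmat (cone F X) 0 k l * join F (Suc 0) a b l)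
      = (\<Sum>l<rk F (Suc 0). dmat F 0 k l * a l) + X * b k" if k: "k < rk F 0"
  proof -
    have "(\<Sum>l<rk F 0. (if l = k then X else 0) * b l) = (\<Sum>l<rk F 0. if l = k then X * b k else 0)"
      by (intro sum.cong) auto
    also have "\<dots> = X * b k" using k by simp
    finally show ?thesis using k by (simp add: sum_lessThan_add cone_def join_def)
  qed
  then show "differential (cone F X) (Suc 0) (join F (Suc 0) a b) k = (differential F (Suc 0) a + (\<lambda>k. X * b k)) k"
    by (auto simp: differential_def b0)
qed

lemma cone_differential:
  assumes "b \<in> monomial_chains F U (Suc i) j'"
  shows "differential (cone F X) (Suc (Suc i)) (join F (Suc (Suc i)) a b) =
    join F (Suc i) (differential F (Suc (Suc i)) a + (\<lambda>k. X * b k)) (- differential F (Suc i) b)"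
proof
  fix k
  let ?r = "rk F (Suc i)" and ?r' = "rk F (Suc (Suc i))"
  have sum: "(\<Sum>l<?r' + ?r. dmat (cone F X) (Suc i) k l * join F (Suc (Suc i)) a b l)
      = (\<Sum>l<?r'. dmat F (Suc i) k l * a l) + X * b k" if k: "k < ?r"
  proof -
    have "(\<Sum>l<?r. (if l = k then X else 0) * b l) = (\<Sum>l<?r. if l = k then X * b k else 0)"
      by (intro sum.cong) auto
    also have "\<dots> = X * b k" using k by simp
    finally show ?thesis using k by (simp add: sum_lessThan_add cone_def join_def)
  qed
  have sum': "(\<Sum>l<?r' + ?r. dmat (cone F X) (Suc i) k l * join F (Suc (Suc i)) a b l)
      = - (\<Sum>l<?r. dmat F i (k - ?r) l * b l)" if k: "\<not> k < ?r"
    using k by (simp add: sum_lessThan_add cone_def join_def sum_negf)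
  show "differential (cone F X) (Suc (Suc i)) (join F (Suc (Suc i)) a b) k =
    join F (Suc i) (differential F (Suc (Suc i)) a + (\<lambda>k. X * b k)) (- differential F (Suc i) b) k"
    using sum sum' by (auto simp: differential_def join_def)
qed

text \<open>\<open>F\<close> resolves $S/(x_1,\dots,x_k)$, with \<open>F\<^sub>0 = S\<close>.\<close>

definition resolves_variables :: "nat \<Rightarrow> nat \<Rightarrow> 'k::field free_complex \<Rightarrow> bool" where
  "resolves_variables n k F \<longleftrightarrow>
    rk F 0 = 1 \<and> shift F 0 0 = 0 \<and>
    (\<forall>i. \<forall>k<rk F i. \<forall>l<rk F (Suc i). dmat F i k l \<in> poly_part n (shift F (Suc i) l - shift F i k)) \<and>
    (\<forall>i j. \<forall>v\<in>monomial_chains F (exponents n) (Suc i) j. differential F i (differential F (Suc i) v) = 0) \<and>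
    (\<forall>i j. \<forall>v\<in>monomial_chains F (exponents n) (Suc i) j. differential F (Suc i) v = 0 \<longrightarrow>
      (\<exists>w\<in>monomial_chains F (exponents n) (Suc (Suc i)) j. v = differential F (Suc (Suc i)) w)) \<and>
    (\<forall>j. \<forall>v\<in>monomial_chains F (exponents n) 0 j.
      keys (v 0) \<subseteq> {m. keys m \<inter> {1..k} \<noteq> {}} \<longleftrightarrow>
      (\<exists>w\<in>monomial_chains F (exponents n) (Suc 0) j. v = differential F (Suc 0) w))"

lemma resolves_no_variables:
  "resolves_variables n 0 \<lparr>rk = (\<lambda>i. if i = 0 then 1 else 0), shift = (\<lambda>i k. 0), dmat = (\<lambda>i k l. 0 :: 'k::field mpoly)\<rparr>"
  (is "resolves_variables n 0 ?F")
proof -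
  have Suc: "v = 0" if "v \<in> monomial_chains ?F U (Suc i) j" for v U i j
    using that by (auto simp: monomial_chains_def fun_eq_iff)
  have zero: "v = 0 \<longleftrightarrow> v 0 = 0" if "v \<in> monomial_chains ?F U 0 j" for v U j
  proof
    assume "v 0 = 0"
    then have "v k = 0" for k using that by (cases k) (auto simp: monomial_chains_def)
    then show "v = 0" by auto
  qed simp
  have Bex: "(\<exists>w\<in>monomial_chains ?F U (Suc i) j. v = differential ?F (Suc i) w) \<longleftrightarrow> v = 0" for v U i j
    using Suc by (metis differential_zero zero_in_monomial_chains)
  have dd: "differential ?F i (differential ?F (Suc i) v) = 0"
    if "v \<in> monomial_chains ?F U (Suc i) j" for v U i j
    using Suc[OF that] by simp
  show ?thesis
    unfolding resolves_variables_def Bex using Suc zero dd by (auto simp: keys_eq_empty)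
qed

text \<open>The cone is exact because $x_{k+1}$ is a nonzerodivisor on $S/(x_1,\dots,x_k)$.\<close>

lemma resolves_next_variable:
  fixes F :: "'k::field free_complex"
  assumes F: "resolves_variables n k F" and k: "k < n"
  shows "resolves_variables n (Suc k) (cone F (single (single (Suc k) 1) 1))"
proof -
  let ?x = "single (Suc k) (1::nat)"
  let ?X = "single ?x (1::'k)"
  let ?G = "cone F ?X" and ?E = "exponents n"
  let ?d = "differential F"
  let ?times = "\<lambda>(b::nat \<Rightarrow> 'k mpoly) k. ?X * b k"
  have rk: "rk F 0 = 1" and sh: "shift F 0 0 = 0"
    and hom: "\<And>i k l. k < rk F i \<Longrightarrow> l < rk F (Suc i) \<Longrightarrow> dmat F i k l \<in> poly_part n (shift F (Suc i) l - shift F i k)"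
    and dd: "\<And>i j v. v \<in> monomial_chains F ?E (Suc i) j \<Longrightarrow> ?d i (?d (Suc i) v) = 0"
    and exact: "\<And>i j v. v \<in> monomial_chains F ?E (Suc i) j \<Longrightarrow> ?d (Suc i) v = 0 \<Longrightarrow>
      \<exists>w\<in>monomial_chains F ?E (Suc (Suc i)) j. v = ?d (Suc (Suc i)) w"
    and aug: "\<And>j v. v \<in> monomial_chains F ?E 0 j \<Longrightarrow>
      keys (v 0) \<subseteq> {m. keys m \<inter> {1..k} \<noteq> {}} \<longleftrightarrow> (\<exists>w\<in>monomial_chains F ?E (Suc 0) j. v = ?d (Suc 0) w)"
    using F unfolding resolves_variables_def by blast+
  have xE: "?x \<in> ?E" using k by (simp add: exponents_def)
  have d_chains: "?d (Suc i) v \<in> monomial_chains F ?E i j" if "v \<in> monomial_chains F ?E (Suc i) j" for i j v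
    by (rule differential_chains[OF hom upset_exponents that])
  have times: "?times b \<in> monomial_chains F ?E i j" if "b \<in> monomial_chains F ?E i (j - 1)" for b i j
  proof -
    have "(+) ?x ` ?E \<subseteq> ?E" using xE by (auto simp: exponents_add_iff)
    from monomial_chains_mono[OF this monomial_chains_times[OF that, of ?x]] show ?thesis by simp
  qed
  have d_times: "?d i (?times b) = ?times (?d i b)" for i b
    by (rule differential_mult)
  have d_uminus: "?d i (- v) = - ?d i v" for i v
    using differential_minus[of F i 0 v] by simp
  have uminus: "- v \<in> monomial_chains F ?E i j" if "v \<in> monomial_chains F ?E i j" for v i j
    using monomial_chains_minus[OF zero_in_monomial_chains that] by simp
  have hom': "dmat ?G i p q \<in> poly_part n (shift ?G (Suc i) q - shift ?G i p)"
    if pq: "p < rk ?G i" "q < rk ?G (Suc i)" for i p q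
  proof -
    have zero: "0 \<in> poly_part n t" for t by (simp add: poly_part_eq monomial_span_def)
    have X: "?X \<in> poly_part n 1" using xE by (simp add: poly_part_eq monomial_span_def)
    show ?thesis
    proof (cases "p < rk F i")
      case True
      then show ?thesis using hom[of p i q] zero X by (auto simp: cone_def)
    next
      case False
      then obtain i' where i': "i = Suc i'" using pq by (cases i) auto
      have "- dmat F i' (p - rk F i) (q - rk F (Suc i)) \<in>
          poly_part n (shift F i (q - rk F (Suc i)) - shift F i' (p - rk F i))"
        if "\<not> q < rk F (Suc i)"
        using hom[of "p - rk F i" i' "q - rk F (Suc i)"] that False pq i'
        by (auto simp: poly_part_eq monomial_span_def keys_uminus)
      then show ?thesis using False i' zero by (auto simp: cone_def)
    qed
  qed
  have dd': "differential ?G i (differential ?G (Suc i) v) = 0"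
    if v: "v \<in> monomial_chains ?G ?E (Suc i) j" for i j v
  proof (cases i)
    case (Suc i')
    obtain a b where ab: "v = join F (Suc (Suc i')) a b"
      "a \<in> monomial_chains F ?E (Suc (Suc i')) j" "b \<in> monomial_chains F ?E (Suc i') (j - 1)"
      using cone_chains_Suc[OF v] unfolding Suc by blast
    have db: "- ?d (Suc i') b \<in> monomial_chains F ?E i' (j - 1)"
      by (intro uminus d_chains ab)
    have eq: "?d (Suc i') (?d (Suc (Suc i')) a + ?times b) + ?times (- ?d (Suc i') b) = 0"
      using dd[OF ab(2)] by (simp only: differential_add d_times) (simp add: fun_eq_iff)
    show ?thesis
    proof (cases i')
      case 0
      show ?thesis
        unfolding Suc ab(1) cone_differential[OF ab(3)] using db eq
        unfolding 0 by (simp only: cone_differential_1[OF db[unfolded 0]])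
    next
      case (Suc i'')
      have "?d i' (- ?d (Suc i') b) = 0" using dd[OF ab(3)] by (simp add: d_uminus)
      then show ?thesis
        unfolding \<open>i = Suc i'\<close> ab(1) cone_differential[OF ab(3)] using eq
        unfolding Suc by (simp only: cone_differential[OF db[unfolded Suc]]) (simp add: join_def fun_eq_iff)
    qed
  qed simp
  \<comment> \<open>A cycle \<open>(a, b)\<close> is a boundary as soon as \<open>b = \<partial>c\<close>: then \<open>a + X c\<close> is a cycle.\<close>
  have lift: "\<exists>w\<in>monomial_chains ?G ?E (Suc (Suc i)) j. join F (Suc i) a (?d (Suc i) c) = differential ?G (Suc (Suc i)) w"
    if a: "a \<in> monomial_chains F ?E (Suc i) j" and c: "c \<in> monomial_chains F ?E (Suc i) (j - 1)"
      and cyc: "?d (Suc i) a + ?times (?d (Suc i) c) = 0" for a c i j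
  proof -
    have "a + ?times c \<in> monomial_chains F ?E (Suc i) j"
      by (intro monomial_chains_add a times c)
    moreover have "?d (Suc i) (a + ?times c) = 0"
      using cyc by (simp only: differential_add d_times)
    ultimately obtain a' where a': "a' \<in> monomial_chains F ?E (Suc (Suc i)) j" "a + ?times c = ?d (Suc (Suc i)) a'"
      using exact by blast
    have nc: "- c \<in> monomial_chains F ?E (Suc i) (j - 1)" by (rule uminus[OF c])
    have "?times (- c) = - ?times c" by (simp add: fun_eq_iff)
    then have "?d (Suc (Suc i)) a' + ?times (- c) = a" using a'(2) by (simp flip: a'(2))
    then have "join F (Suc i) a (?d (Suc i) c) = differential ?G (Suc (Suc i)) (join F (Suc (Suc i)) a' (- c))"
      using cone_differential[OF nc, of ?X a'] by (simp add: d_uminus)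
    then show ?thesis using join_chains[OF a'(1) nc] by blast
  qed
  have exact': "\<exists>w\<in>monomial_chains ?G ?E (Suc (Suc i)) j. v = differential ?G (Suc (Suc i)) w"
    if v: "v \<in> monomial_chains ?G ?E (Suc i) j" and dv: "differential ?G (Suc i) v = 0" for i j v
  proof -
    obtain a b where ab: "v = join F (Suc i) a b"
      "a \<in> monomial_chains F ?E (Suc i) j" "b \<in> monomial_chains F ?E i (j - 1)"
      using cone_chains_Suc[OF v] by blast
    have "(\<exists>c\<in>monomial_chains F ?E (Suc i) (j - 1). b = ?d (Suc i) c) \<and> ?d (Suc i) a + ?times b = 0"
    proof (cases i)
      case 0
      have eq: "?d (Suc 0) a + ?times b = 0"
        using dv cone_differential_1[of b F ?E "j - 1" ?X a] ab 0 by simp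
      have "?times b = ?d (Suc 0) (- a)" using eq by (simp add: d_uminus add_eq_0_iff)
      moreover have "- a \<in> monomial_chains F ?E (Suc 0) j" using uminus ab(2) 0 by blast
      ultimately have "keys (?X * b 0) \<subseteq> {m. keys m \<inter> {1..k} \<noteq> {}}"
        using aug[OF times[of b 0 j]] ab(3) 0 by blast
      \<comment> \<open>\<open>X b\<close> lies in the ideal of the first \<open>k\<close> variables, and \<open>X\<close> is a nonzerodivisor modulo it.\<close>
      then have "keys (b 0) \<subseteq> {m. keys m \<inter> {1..k} \<noteq> {}}"
        by (auto simp: keys_single_times keys_add_nat image_subset_iff)
      then show ?thesis using aug ab(3) 0 eq by blast
    next
      case (Suc i')
      have b: "b \<in> monomial_chains F ?E (Suc i') (j - 1)" using ab(3) Suc by simp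
      have "join F i (?d (Suc i) a + ?times b) (- ?d i b) = join F i 0 0"
        using dv cone_differential[OF b, of ?X a] ab Suc by (simp add: join_def fun_eq_iff)
      moreover have "?d (Suc i) a + ?times b \<in> monomial_chains F ?E i j"
        by (intro monomial_chains_add d_chains times ab)
      ultimately have "?d (Suc i) a + ?times b = 0" "- ?d i b = 0"
        using join_inject[of _ F ?E i j 0] zero_in_monomial_chains by blast+
      then show ?thesis using exact[OF b] Suc by simp
    qed
    then show ?thesis using lift[OF ab(2)] ab(1) by blast
  qed
  have aug': "keys (v 0) \<subseteq> {m. keys m \<inter> {1..Suc k} \<noteq> {}} \<longleftrightarrow>
      (\<exists>w\<in>monomial_chains ?G ?E (Suc 0) j. v = differential ?G (Suc 0) w)"
    if "v \<in> monomial_chains ?G ?E 0 j" for j v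
  proof -
    have v: "v \<in> monomial_chains F ?E 0 j" using that by (simp add: cone_chains_0)
    let ?J = "{m \<in> ?E. keys m \<inter> {1..k} \<noteq> {}}"
    have split: "{m \<in> ?E. keys m \<inter> {1..Suc k} \<noteq> {}} \<subseteq> ?J \<union> (+) ?x ` ?E"
    proof
      fix m assume m: "m \<in> {m \<in> ?E. keys m \<inter> {1..Suc k} \<noteq> {}}"
      show "m \<in> ?J \<union> (+) ?x ` ?E"
      proof (cases "Suc k \<in> keys m")
        case True
        then have "m = ?x + (m - ?x)"
          by (intro poly_mapping_eqI) (auto simp: lookup_add lookup_minus lookup_single when_def in_keys_iff)
        moreover have "m - ?x \<in> ?E" using m calculation exponents_add_iff by (metis (mono_tags) mem_Collect_eq)
        ultimately show ?thesis by blast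
      next
        case False
        then show ?thesis using m by (auto simp: atLeastAtMostSuc_conv)
      qed
    qed
    show ?thesis
    proof
      assume "keys (v 0) \<subseteq> {m. keys m \<inter> {1..Suc k} \<noteq> {}}"
      then have "v \<in> monomial_chains F {m \<in> ?E. keys m \<inter> {1..Suc k} \<noteq> {}} 0 j"
        using v rk by (auto simp: monomial_chains_def)
      then have "v \<in> monomial_chains F (?J \<union> (+) ?x ` ?E) 0 j" by (rule monomial_chains_mono[OF split])
      then obtain p q where pq: "v = p + q" "p \<in> monomial_chains F ?J 0 j" "q \<in> monomial_chains F ((+) ?x ` ?E) 0 j"
        by (rule split_monomial_chains)
      have "keys (p 0) \<subseteq> {m. keys m \<inter> {1..k} \<noteq> {}}" using pq(2) rk by (auto simp: monomial_chains_def)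
      moreover have "p \<in> monomial_chains F ?E 0 j" by (rule monomial_chains_mono[OF _ pq(2)]) auto
      ultimately obtain a where a: "a \<in> monomial_chains F ?E (Suc 0) j" "p = ?d (Suc 0) a" using aug by blast
      obtain b where b: "b \<in> monomial_chains F ?E 0 (j - 1)" "q = ?times b"
        using divide_monomial_chains[of q F ?x ?E 0 "j - 1"] pq(3) by auto
      have "v = differential ?G (Suc 0) (join F (Suc 0) a b)"
        by (simp add: cone_differential_1[OF b(1)] pq(1) a(2) b(2))
      then show "\<exists>w\<in>monomial_chains ?G ?E (Suc 0) j. v = differential ?G (Suc 0) w"
        using join_chains[OF a(1) b(1)] by blast
    next
      assume "\<exists>w\<in>monomial_chains ?G ?E (Suc 0) j. v = differential ?G (Suc 0) w"
      then obtain w where w: "w \<in> monomial_chains ?G ?E (Suc 0) j" "v = differential ?G (Suc 0) w" by blast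
      obtain a b where ab: "w = join F (Suc 0) a b"
        "a \<in> monomial_chains F ?E (Suc 0) j" "b \<in> monomial_chains F ?E 0 (j - 1)"
        using cone_chains_Suc[OF w(1)] by blast
      have "keys (?d (Suc 0) a 0) \<subseteq> {m. keys m \<inter> {1..k} \<noteq> {}}"
        using aug[OF d_chains[OF ab(2)]] ab(2) by blast
      then have "keys (?d (Suc 0) a 0) \<subseteq> {m. keys m \<inter> {1..Suc k} \<noteq> {}}" by fastforce
      moreover have "keys (?X * b 0) \<subseteq> {m. keys m \<inter> {1..Suc k} \<noteq> {}}"
        by (auto simp: keys_single_times keys_add_nat)
      ultimately show "keys (v 0) \<subseteq> {m. keys m \<inter> {1..Suc k} \<noteq> {}}"
        unfolding w(2) ab(1) cone_differential_1[OF ab(3)] by (simp add: keys_plus_subset)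
    qed
  qed
  have "rk ?G 0 = 1" "shift ?G 0 0 = 0" using rk sh by (auto simp: cone_def)
  then show ?thesis
    unfolding resolves_variables_def using hom' dd' exact' aug' by blast
qed

lemma residue_field_resolution_exists:
  "\<exists>(F::'k::field free_complex) aug. is_graded_free_resolution n (residue_field :: ('k, 'k) graded_module) F aug"
proof -
  have "\<exists>F::'k free_complex. resolves_variables n k F" if "k \<le> n" for k
    using that
  proof (induction k)
    case 0
    then show ?case using resolves_no_variables by blast
  next
    case (Suc k)
    then obtain F :: "'k free_complex" where "resolves_variables n k F" by auto
    then have "resolves_variables n (Suc k) (cone F (single (single (Suc k) 1) 1))"
      using Suc.prems by (intro resolves_next_variable) auto
    then show ?case by blast
  qed
  then obtain F :: "'k free_complex" where F: "resolves_variables n n F" by blast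
  let ?E = "exponents n"
  have rk: "rk F 0 = 1" and sh: "shift F 0 0 = 0"
    using F unfolding resolves_variables_def by blast+
  have sum: "(\<Sum>k<rk F 0. act residue_field (v k) 1) = (lookup (v 0) 0 :: 'k)" for v
    by (simp add: rk residue_field_def)
  have im: "(\<lambda>v. lookup (v 0) 0) ` monomial_chains F ?E 0 j = (part residue_field j :: 'k set)" for j
  proof (cases "j = 0")
    case True
    have "c \<in> (\<lambda>v. lookup (v 0) 0) ` monomial_chains F ?E 0 j" for c :: 'k
      by (rule image_eqI[of _ _ "\<lambda>k. if k = 0 then const c else 0"])
        (auto simp: const_def monomial_chains_def rk sh True)
    then show ?thesis using True by (auto simp: residue_field_def)
  next
    case False
    have "lookup (v 0) 0 = 0" if "v \<in> monomial_chains F ?E 0 j" for v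
    proof (rule ccontr)
      assume "lookup (v 0) 0 \<noteq> 0"
      then have "0 \<in> keys (v 0)" by (simp add: in_keys_iff)
      then show False using that False rk sh by (auto simp: monomial_chains_def)
    qed
    then show ?thesis using False by (auto simp: residue_field_def intro: image_eqI[OF _ zero_in_monomial_chains])
  qed
  have d_chains: "differential F (Suc i) w \<in> monomial_chains F ?E i j"
    if "w \<in> monomial_chains F ?E (Suc i) j" for i j w
    by (rule differential_chains[OF _ upset_exponents that])
      (use F in \<open>unfold resolves_variables_def, blast\<close>)
  have cyc: "cycles F (ring_module n) (Suc i) j = boundaries F (ring_module n) (Suc i) j" for i j
  proof -
    have "differential F (Suc (Suc i)) w \<in> monomial_chains F ?E (Suc i) j"
      if "w \<in> monomial_chains F ?E (Suc (Suc i)) j" for w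
      by (rule d_chains[OF that])
    moreover have "differential F (Suc i) (differential F (Suc (Suc i)) v) = 0"
      if "v \<in> monomial_chains F ?E (Suc (Suc i)) j" for v
      using F that unfolding resolves_variables_def by blast
    moreover have "\<exists>w\<in>monomial_chains F ?E (Suc (Suc i)) j. v = differential F (Suc (Suc i)) w"
      if "v \<in> monomial_chains F ?E (Suc i) j" "differential F (Suc i) v = 0" for v
      using F that unfolding resolves_variables_def by blast
    ultimately show ?thesis
      unfolding cycles.simps boundaries_def chains_ring_module bd_ring_module zero_fun_def[symmetric]
      by blast
  qed
  have aug: "{v \<in> monomial_chains F ?E 0 j. lookup (v 0) 0 = 0} = boundaries F (ring_module n) 0 j" for j
  proof -
    have "differential F (Suc 0) w \<in> monomial_chains F ?E 0 j" if "w \<in> monomial_chains F ?E (Suc 0) j" for w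
      by (rule d_chains[OF that])
    moreover have "lookup (v 0) 0 = 0 \<longleftrightarrow> keys (v 0) \<subseteq> {m. keys m \<inter> {1..n} \<noteq> {}}"
      if "v \<in> monomial_chains F ?E 0 j" for v
    proof -
      have E: "keys (v 0) \<subseteq> ?E" using that rk by (auto simp: monomial_chains_def)
      have "m \<noteq> 0 \<longleftrightarrow> keys m \<inter> {1..n} \<noteq> {}" if "m \<in> ?E" for m
        using that by (auto simp: exponents_def keys_eq_empty Int_absorb2)
      then have "0 \<notin> keys (v 0) \<longleftrightarrow> keys (v 0) \<subseteq> {m. keys m \<inter> {1..n} \<noteq> {}}"
        using E by blast
      then show ?thesis by (simp add: in_keys_iff)
    qed
    moreover have "keys (v 0) \<subseteq> {m. keys m \<inter> {1..n} \<noteq> {}} \<longleftrightarrow>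
        (\<exists>w\<in>monomial_chains F ?E (Suc 0) j. v = differential F (Suc 0) w)"
      if "v \<in> monomial_chains F ?E 0 j" for v
      using F that unfolding resolves_variables_def by blast
    ultimately show ?thesis
      unfolding boundaries_def chains_ring_module bd_ring_module by blast
  qed
  have "is_graded_free_resolution n residue_field F (\<lambda>k. 1)"
    unfolding is_graded_free_resolution_def sum chains_ring_module
  proof (intro conjI)
    show "\<forall>k<rk F 0. (1::'k) \<in> part residue_field (shift F 0 k)"
      by (simp add: rk sh residue_field_def)
    show "\<forall>i. \<forall>k<rk F i. \<forall>l<rk F (Suc i). dmat F i k l \<in> poly_part n (shift F (Suc i) l - shift F i k)"
      using F unfolding resolves_variables_def by (elim conjE)
    show "\<forall>j. (\<lambda>v. lookup (v 0) 0) ` monomial_chains F ?E 0 j = (part residue_field j :: 'k set)"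
      using im by (rule allI)
    show "\<forall>j. {v \<in> monomial_chains F ?E 0 j. lookup (v 0) 0 = 0} = boundaries F (ring_module n) 0 j"
      using aug by (rule allI)
    show "\<forall>i j. cycles F (ring_module n) (Suc i) j = boundaries F (ring_module n) (Suc i) j"
      using cyc by (intro allI)
  qed
  then show ?thesis by blast
qed

section \<open>Betti numbers of monomial ideals\<close>

lemma residue_resolutionI:
  fixes F :: "'k::field free_complex"
  assumes "is_graded_free_resolution n (residue_field :: ('k, 'k) graded_module) F aug"
  shows "residue_resolution n F"
proof -
  let ?E = "exponents n"
  have hom: "dmat F i k l \<in> poly_part n (shift F (Suc i) l - shift F i k)"
    if "k < rk F i" "l < rk F (Suc i)" for i k l
    using assms that unfolding is_graded_free_resolution_def by blast
  have im: "(\<lambda>v. \<Sum>k<rk F 0. act residue_field (v k) (aug k)) ` monomial_chains F ?E 0 j = part residue_field j"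
    and ker: "{v \<in> monomial_chains F ?E 0 j. (\<Sum>k<rk F 0. act residue_field (v k) (aug k)) = 0} =
      boundaries F (ring_module n) 0 j"
    and cyc: "cycles F (ring_module n) (Suc i) j = boundaries F (ring_module n) (Suc i) j" for i j
    using assms unfolding is_graded_free_resolution_def chains_ring_module by blast+
  have bnd: "boundaries F (ring_module n) i j = differential F (Suc i) ` monomial_chains F ?E (Suc i) j" for i j
    by (simp add: boundaries_def chains_ring_module bd_ring_module)
  have cyc': "{v \<in> monomial_chains F ?E (Suc i) j. differential F (Suc i) v = 0} =
      differential F (Suc (Suc i)) ` monomial_chains F ?E (Suc (Suc i)) j" for i j
    using cyc[of i j] unfolding bnd by (simp add: chains_ring_module bd_ring_module zero_fun_def)
  show ?thesis
  proof
    fix v i j assume "v \<in> monomial_chains F ?E (Suc i) j"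
    then show "differential F i (differential F (Suc i) v) = 0"
      using cyc' by (cases i) auto
  next
    fix v i j
    assume v: "v \<in> monomial_chains F ?E i j" "differential F i v = 0" "i \<noteq> 0 \<or> j \<noteq> 0"
    show "\<exists>w\<in>monomial_chains F ?E (Suc i) j. v = differential F (Suc i) w"
    proof (cases i)
      case 0
      then have "(\<Sum>k<rk F 0. act residue_field (v k) (aug k)) \<in> part residue_field j"
        using im[of j] v(1) by blast
      then have "(\<Sum>k<rk F 0. act residue_field (v k) (aug k)) = 0"
        using v(3) 0 by (simp add: residue_field_def)
      then show ?thesis using ker[of j] v(1) 0 unfolding bnd by blast
    next
      case (Suc i')
      then show ?thesis using cyc'[of i' j] v by blast
    qed
  qed (rule hom)
qed

text \<open>The resolution of the residue field that is chosen in the definition of the Betti numbers.\<close>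

definition residue_field_resolution :: "nat \<Rightarrow> 'k::field free_complex" where
  "residue_field_resolution n =
    (SOME F. \<exists>aug. is_graded_free_resolution n (residue_field :: ('k, 'k) graded_module) F aug)"

lemma residue_field_resolution:
  obtains aug where "is_graded_free_resolution n (residue_field :: ('k::field, 'k) graded_module)
    (residue_field_resolution n) aug"
  using someI_ex[OF residue_field_resolution_exists[of n, where 'k='k]]
  unfolding residue_field_resolution_def by blast

lemma residue_resolution_chosen: "residue_resolution n (residue_field_resolution n)"
  by (rule residue_field_resolution, rule residue_resolutionI)

lemma betti_monomial_span:
  assumes "U \<subseteq> exponents n"
  shows "betti n (ideal_module n (monomial_span U :: 'k::field mpoly set)) i j =
    residue_resolution.tor_dimension (residue_field_resolution n :: 'k free_complex) U i j"
proof -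
  interpret chosen: residue_resolution n "residue_field_resolution n :: 'k free_complex"
    by (rule residue_resolution_chosen)
  let ?F = "residue_field_resolution n :: 'k free_complex"
  let ?M = "ideal_module n (monomial_span U :: 'k mpoly set)"
  have "cycles ?F ?M i j = {v \<in> monomial_chains ?F U i j. differential ?F i v = 0}"
    by (cases i) (simp_all add: chains_ideal_module[OF assms] bd_ideal_module zero_fun_def)
  moreover have "boundaries ?F ?M i j = differential ?F (Suc i) ` monomial_chains ?F U (Suc i) j"
    by (simp add: boundaries_def chains_ideal_module[OF assms] bd_ideal_module)
  moreover have "act ?M = (*)" by (simp add: ideal_module_def)
  ultimately show ?thesis
    unfolding betti_def tor_dim_def Let_def residue_field_resolution_def[symmetric]
      chosen.tor_dimension_def by simp
qed

lemma lookup_times_minimal_degree: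
  fixes p q :: "'k::field mpoly"
  assumes "\<And>m. m \<in> keys q \<Longrightarrow> mon_degree \<mu> \<le> mon_degree m"
  shows "lookup (p * q) \<mu> = lookup p 0 * lookup q \<mu>"
proof -
  let ?c = "single 0 (lookup p 0)"
  have "\<mu> \<notin> keys ((p - ?c) * q)"
  proof
    assume "\<mu> \<in> keys ((p - ?c) * q)"
    then obtain a b where ab: "\<mu> = a + b" "a \<in> keys (p - ?c)" "b \<in> keys q"
      using keys_mult by blast
    then have "mon_degree a = 0" using assms[of b] by (simp add: mon_degree_add)
    then have "a = 0" by (simp add: mon_degree_eq_0_iff)
    then show False using ab(2) by (simp add: in_keys_iff lookup_minus)
  qed
  then have "lookup ((p - ?c) * q) \<mu> = 0" by (simp add: in_keys_iff)
  moreover have "lookup (?c * q) \<mu> = lookup p 0 * lookup q \<mu>"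
    using lookup_single_times[of 0 "lookup p 0" q \<mu>] by simp
  moreover have "p * q = (p - ?c) * q + ?c * q" by (simp add: algebra_simps)
  ultimately show ?thesis by (simp add: lookup_add)
qed

text \<open>A monomial of least degree in a monomial ideal \<open>I\<close> is a minimal generator. The functional that
  separates its class in \<open>K \<otimes> I\<close> from the boundaries takes the coefficient at this monomial
  after augmentation.\<close>

lemma betti_minimal_degree_nonzero:
  assumes U: "upset n U" and \<mu>: "\<mu> \<in> U" and min: "\<And>m. m \<in> U \<Longrightarrow> mon_degree \<mu> \<le> mon_degree m"
  shows "betti n (ideal_module n (monomial_span U :: 'k::field mpoly set)) 0 (int (mon_degree \<mu>)) \<noteq> 0"
proof -
  interpret chosen: residue_resolution n "residue_field_resolution n :: 'k free_complex"
    by (rule residue_resolution_chosen)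
  let ?F = "residue_field_resolution n :: 'k free_complex" and ?j = "int (mon_degree \<mu>)"
  let ?E = "exponents n"
  obtain aug where aug: "is_graded_free_resolution n (residue_field :: ('k, 'k) graded_module) ?F aug"
    by (rule residue_field_resolution)
  have im: "(\<lambda>v. \<Sum>k<rk ?F 0. lookup (v k) 0 * aug k) ` monomial_chains ?F ?E 0 0 = UNIV"
    and ker: "{v \<in> monomial_chains ?F ?E 0 j. (\<Sum>k<rk ?F 0. lookup (v k) 0 * aug k) = 0} =
      boundaries ?F (ring_module n) 0 j" for j
    using aug unfolding is_graded_free_resolution_def chains_ring_module
    by (simp_all add: residue_field_def)
  obtain v where v: "v \<in> monomial_chains ?F ?E 0 0" "(\<Sum>k<rk ?F 0. lookup (v k) 0 * aug k) = 1"
    using im by (metis (no_types, lifting) UNIV_I imageE)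
  define \<phi> where "\<phi> u = (\<Sum>k<rk ?F 0. lookup (u k) \<mu> * aug k)" for u
  let ?v = "\<lambda>k. single \<mu> 1 * v k"
  have "(+) \<mu> ` ?E \<subseteq> U" using U \<mu> by (auto simp: upset_def add.commute)
  from monomial_chains_mono[OF this monomial_chains_times[OF v(1)]]
  have v_in: "?v \<in> monomial_chains ?F U 0 ?j" by simp
  have \<phi>v: "\<phi> ?v = 1"
    using v(2) lookup_single_times[of \<mu> "1::'k" _ 0] by (simp add: \<phi>_def)
  \<comment> \<open>The augmentation vanishes on each column of the first differential.\<close>
  have column: "(\<Sum>k<rk ?F 0. lookup (dmat ?F 0 k l) 0 * aug k) = 0" if l: "l < rk ?F (Suc 0)" for l
  proof -
    let ?\<epsilon> = "\<lambda>l'. if l' = l then 1 else (0::'k mpoly)"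
    have "?\<epsilon> \<in> monomial_chains ?F ?E (Suc 0) (shift ?F (Suc 0) l)"
      using l by (auto simp: monomial_chains_def)
    then have "differential ?F (Suc 0) ?\<epsilon> \<in> boundaries ?F (ring_module n) 0 (shift ?F (Suc 0) l)"
      unfolding boundaries_def chains_ring_module bd_ring_module by blast
    then have "(\<Sum>k<rk ?F 0. lookup (differential ?F (Suc 0) ?\<epsilon> k) 0 * aug k) = 0"
      using ker by blast
    moreover have "differential ?F (Suc 0) ?\<epsilon> k = dmat ?F 0 k l" if "k < rk ?F 0" for k
    proof -
      have "(\<Sum>l'<rk ?F (Suc 0). dmat ?F 0 k l' * ?\<epsilon> l') = (\<Sum>l'<rk ?F (Suc 0). if l' = l then dmat ?F 0 k l else 0)"
        by (intro sum.cong) auto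
      then show ?thesis using that l by (simp add: differential_def)
    qed
    ultimately show ?thesis by simp
  qed
  have \<phi>_bnd: "\<phi> (differential ?F (Suc 0) w) = 0" if w: "w \<in> monomial_chains ?F U (Suc 0) ?j" for w
  proof -
    have lk: "lookup (dmat ?F 0 k l * w l) \<mu> = lookup (dmat ?F 0 k l) 0 * lookup (w l) \<mu>"
      if "l < rk ?F (Suc 0)" for k l
      by (rule lookup_times_minimal_degree, rule min) (use w that in \<open>auto simp: monomial_chains_def\<close>)
    have "\<phi> (differential ?F (Suc 0) w) =
        (\<Sum>k<rk ?F 0. \<Sum>l<rk ?F (Suc 0). lookup (dmat ?F 0 k l) 0 * lookup (w l) \<mu> * aug k)"
      by (simp add: \<phi>_def differential_def lookup_sum lk sum_distrib_right)
    also have "\<dots> = (\<Sum>l<rk ?F (Suc 0). lookup (w l) \<mu> * (\<Sum>k<rk ?F 0. lookup (dmat ?F 0 k l) 0 * aug k))"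
      by (subst sum.swap) (simp add: sum_distrib_left algebra_simps)
    also have "\<dots> = 0" by (simp add: column)
    finally show ?thesis .
  qed
  have "?v \<notin> differential ?F (Suc 0) ` monomial_chains ?F U (Suc 0) ?j"
    using \<phi>v \<phi>_bnd by (metis (no_types, lifting) imageE zero_neq_one)
  moreover obtain E where "finite E" "chosen.cyc U 0 ?j \<subseteq> family.span E"
    using chosen.cyc_finite_dimensional[OF U] by blast
  ultimately have "chosen.tor_dimension U 0 ?j > 0"
    unfolding chosen.tor_dimension_def using v_in
    by (intro family.dim_quotient_pos chosen.subspace_bnd chosen.bnd_subset_cyc[OF U]) auto
  then show ?thesis
    using betti_monomial_span[of U n 0 ?j, where 'k='k] U by (simp add: upset_def)
qed

section \<open>Removing circuits at a simplicial element\<close>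

lemma clutter_compl_subset: "clutter_compl n d C \<subseteq> all_circuits n d"
  by (auto simp: clutter_compl_def)

lemma upset_circuit_exponents: "C \<subseteq> all_circuits n d \<Longrightarrow> upset n (circuit_exponents n C)"
  by (simp add: circuit_exponents_generated upset_generated)

lemma betti_circuit_ideal:
  assumes "C \<subseteq> all_circuits n d"
  shows "betti n (ideal_module n (circuit_ideal (K::'k::field itself) n C)) i j =
    residue_resolution.tor_dimension (residue_field_resolution n :: 'k free_complex) (circuit_exponents n C) i j"
  using upset_circuit_exponents[OF assms]
  by (simp add: circuit_ideal_eq[OF assms] betti_monomial_span upset_def)

lemma simplicial_circuit:
  assumes "e \<in> Simp n d C" "F \<in> C" "e \<subset> F" "C \<subseteq> all_circuits n d"
  obtains c where "c \<notin> e" "F = insert c e" "c \<in> {1..n}" "finite e"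
proof -
  have F: "F \<subseteq> {1..n}" "card F = d" using assms by (auto simp: all_circuits_def)
  then have fin: "finite F" "finite e"
    using assms(3) finite_subset[of F "{1..n}"] finite_subset[of e F] by auto
  have "card e + 1 = d" using assms by (simp add: Simp_def)
  then have "card (F - e) = 1" using assms(3) F fin by (simp add: card_Diff_subset psubset_imp_subset)
  then obtain c where "F - e = {c}" by (rule card_1_singletonE)
  then have "c \<notin> e" "F = insert c e" using assms(3) by auto
  then show thesis using that F fin by auto
qed

lemma simplicial_remove_circuit:
  assumes "e \<in> Simp n d C" "F \<in> C" "e \<subset> F" "C \<subseteq> all_circuits n d"
  shows "e \<in> Simp n d (C - {F})"
proof -
  obtain c where c: "c \<notin> e" "F = insert c e" by (rule simplicial_circuit[OF assms])
  have sub: "closed_nbhd n (C - {F}) e \<subseteq> closed_nbhd n C e - {c}"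
    using c by (auto simp: closed_nbhd_def)
  have clique: "is_clique n d C (closed_nbhd n C e)" using assms(1) by (simp add: Simp_def)
  have "T \<in> C - {F}" if "T \<subseteq> closed_nbhd n (C - {F}) e" "card T = d" for T
    using that sub clique c unfolding is_clique_def by blast
  then have "is_clique n d (C - {F}) (closed_nbhd n (C - {F}) e)"
    using sub clique unfolding is_clique_def by blast
  then show ?thesis using assms(1) by (simp add: Simp_def)
qed

text \<open>The variables \<open>W\<close> outside the closed neighbourhood of \<open>e\<close> generate the colon ideal of
  \<open>x\<^sub>F\<close>, because the neighbourhood is a clique.\<close>

lemma betti_remove_circuit:
  fixes K :: "'k::field itself"
  assumes C: "C \<subseteq> all_circuits n d" and e: "e \<in> Simp n d C" and F: "F \<in> C" "e \<subset> F"
  defines "b \<equiv> \<lambda>C. betti n (ideal_module n (circuit_ideal K n (clutter_compl n d C)))"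
  shows "j \<noteq> int i + int d \<Longrightarrow> b C i j = b (C - {F}) i j" and "b C i j \<le> b (C - {F}) i j"
proof -
  obtain c where c: "c \<notin> e" "F = insert c e" "c \<in> {1..n}" and fin: "finite e"
    by (rule simplicial_circuit[OF e F C])
  define N where "N = closed_nbhd n C e"
  define W where "W = {1..n} - N"
  let ?G = "generated n ((\<lambda>w. single w (1::nat)) ` W)"
  let ?U = "circuit_exponents n (clutter_compl n d C)"
  let ?f = "squarefree_exponent F" and ?\<epsilon> = "squarefree_exponent e"
  have Fd: "F \<in> all_circuits n d" using F C by blast
  have e': "e \<subseteq> {1..n}" "card e + 1 = d" and clique: "\<And>T. T \<subseteq> N \<Longrightarrow> card T = d \<Longrightarrow> T \<in> C"
    using e by (auto simp: Simp_def is_clique_def N_def)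
  have FN: "F \<subseteq> N" using F c by (auto simp: N_def closed_nbhd_def)
  have finF: "finite F" using c fin by simp
  have f: "?f = ?\<epsilon> + single c 1"
    using fin c by (simp add: squarefree_exponent_def add.commute)
  have \<epsilon>E: "?\<epsilon> \<in> exponents n" using e' fin by (simp add: exponents_def keys_squarefree_exponent)
  have fE: "?f \<in> exponents n" using e' finF c by (simp add: exponents_def keys_squarefree_exponent)
  have degf: "mon_degree ?f = d"
    using Fd finF by (simp add: mon_degree_squarefree_exponent all_circuits_def)
  have G: "m \<in> ?G \<longleftrightarrow> m \<in> exponents n \<and> keys m \<inter> W \<noteq> {}" for m
  proof -
    have "(\<forall>i. lookup (single w (1::nat)) i \<le> lookup m i) \<longleftrightarrow> w \<in> keys m" for w
      by (auto simp: lookup_single when_def in_keys_iff Suc_le_eq)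
    then show ?thesis by (auto simp: generated_def)
  qed
  have new: "insert w e \<in> clutter_compl n d C" if w: "w \<in> W" for w
  proof -
    have "w \<notin> e" "insert w e \<notin> C" "w \<in> {1..n}" using w by (auto simp: W_def N_def closed_nbhd_def)
    then show ?thesis using e' fin by (auto simp: clutter_compl_def all_circuits_def)
  qed
  have U_iff: "?f + a \<in> ?U \<longleftrightarrow> a \<in> ?G" if a: "a \<in> exponents n" for a
  proof
    assume "?f + a \<in> ?U"
    then obtain T where T: "T \<in> clutter_compl n d C" "T \<subseteq> F \<union> keys a"
      by (auto simp: circuit_exponents_def keys_add_nat keys_squarefree_exponent[OF finF])
    then have "\<not> T \<subseteq> N" using clique by (auto simp: clutter_compl_def all_circuits_def)
    then have "keys a \<inter> W \<noteq> {}" using T FN by (auto simp: W_def clutter_compl_def all_circuits_def)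
    then show "a \<in> ?G" using a G by simp
  next
    assume "a \<in> ?G"
    then obtain w where "w \<in> keys a" "w \<in> W" using G by blast
    then have "insert w e \<subseteq> keys (?f + a)" "insert w e \<in> clutter_compl n d C"
      using c(2) new unfolding keys_add_nat keys_squarefree_exponent[OF finF] by blast+
    then have "\<exists>T\<in>clutter_compl n d C. T \<subseteq> keys (?f + a)" by blast
    then show "?f + a \<in> ?U" using a fE by (simp add: circuit_exponents_def exponents_add_iff)
  qed
  have colon: "(+) ?f ` exponents n \<inter> ?U = (+) ?f ` ?G"
    using U_iff generated_subset_exponents by blast
  have lower: "(+) ?\<epsilon> ` ?G \<subseteq> ?U"
  proof
    fix m assume "m \<in> (+) ?\<epsilon> ` ?G"
    then obtain g w where g: "m = ?\<epsilon> + g" "g \<in> exponents n" "w \<in> keys g" "w \<in> W" using G by blast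
    then have "insert w e \<subseteq> keys m" by (auto simp: keys_add_nat keys_squarefree_exponent[OF fin])
    then have "\<exists>T\<in>clutter_compl n d C. T \<subseteq> keys m" using new[OF g(4)] by blast
    then show "m \<in> ?U" using g(1,2) \<epsilon>E by (simp add: circuit_exponents_def exponents_add_iff)
  qed
  have "clutter_compl n d (C - {F}) = insert F (clutter_compl n d C)"
    using Fd by (auto simp: clutter_compl_def)
  moreover have "circuit_exponents n (insert F (clutter_compl n d C)) = (+) ?f ` exponents n \<union> ?U"
    using Fd clutter_compl_subset[of n d C]
    by (simp add: circuit_exponents_generated generated_insert[OF fE])
  ultimately have V: "circuit_exponents n (clutter_compl n d (C - {F})) = (+) ?f ` exponents n \<union> ?U"
    by simp
  note * = residue_resolution.tor_dimension_add_monomial[OF residue_resolution_chosen[where 'a='k],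
      where W = W and \<epsilon> = ?\<epsilon> and c = c and f = ?f and r = d and U = ?U,
      OF _ \<epsilon>E c(3) upset_circuit_exponents[OF clutter_compl_subset] f degf colon lower]
  have W: "W \<subseteq> {1..n}" by (auto simp: W_def)
  show "j \<noteq> int i + int d \<Longrightarrow> b C i j = b (C - {F}) i j" and "b C i j \<le> b (C - {F}) i j"
    unfolding b_def betti_circuit_ideal[OF clutter_compl_subset] V by (rule *[OF W], assumption?)+
qed

lemma betti_remove_circuits:
  fixes K :: "'k::field itself"
  assumes C: "C \<subseteq> all_circuits n d" and e: "e \<in> Simp n d C" and A: "A \<subseteq> {F \<in> C. e \<subset> F}"
  defines "b \<equiv> \<lambda>C. betti n (ideal_module n (circuit_ideal K n (clutter_compl n d C)))"
  shows "(j \<noteq> int i + int d \<longrightarrow> b C i j = b (C - A) i j) \<and> b C i j \<le> b (C - A) i j"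
proof -
  have "A \<subseteq> all_circuits n d" using A C by blast
  then have "finite A" by (rule finite_subset[OF _ all_circuits_finite(1)])
  then have "e \<in> Simp n d (C - A) \<and> (j \<noteq> int i + int d \<longrightarrow> b C i j = b (C - A) i j) \<and> b C i j \<le> b (C - A) i j"
    using A
  proof (induction A rule: finite_induct)
    case (insert F A)
    then have IH: "e \<in> Simp n d (C - A)"
      "(j \<noteq> int i + int d \<longrightarrow> b C i j = b (C - A) i j) \<and> b C i j \<le> b (C - A) i j" by auto
    have F: "F \<in> C - A" "e \<subset> F" and C': "C - A \<subseteq> all_circuits n d" using insert C by auto
    have "C - insert F A = C - A - {F}" by blast
    then show ?case
      using IH simplicial_remove_circuit[OF IH(1) F C'] betti_remove_circuit[OF C' IH(1) F, where j = j and i = i and K = K]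
      unfolding b_def by simp
  qed (use e in simp)
  then show ?thesis by blast
qed

section \<open>Regularity, index and projective dimension\<close>

lemma card_le_mon_degree:
  assumes "T \<subseteq> keys m"
  shows "card T \<le> mon_degree m"
proof -
  have "card T \<le> card (keys m)" using assms by (simp add: card_mono)
  also have "\<dots> = (\<Sum>i\<in>keys m. 1)" by simp
  also have "\<dots> \<le> mon_degree m"
    unfolding mon_degree_def by (intro sum_mono) (simp add: in_keys_iff Suc_le_eq)
  finally show ?thesis .
qed

lemma circuit_exponents_degree:
  assumes "C \<subseteq> all_circuits n d" "m \<in> circuit_exponents n C"
  shows "d \<le> mon_degree m"
proof -
  obtain T where T: "T \<in> C" "T \<subseteq> keys m" using assms(2) by (auto simp: circuit_exponents_def)
  then have "card T = d" using assms(1) by (auto simp: all_circuits_def)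
  then show ?thesis using card_le_mon_degree[OF T(2)] by simp
qed

lemma squarefree_in_circuit_exponents:
  assumes "C \<subseteq> all_circuits n d" "T \<in> C"
  shows "squarefree_exponent T \<in> circuit_exponents n C" "mon_degree (squarefree_exponent T) = d"
proof -
  have T: "T \<subseteq> {1..n}" "card T = d" "finite T"
    using assms all_circuits_finite(2)[of T n d] unfolding all_circuits_def by blast+
  then show "squarefree_exponent T \<in> circuit_exponents n C" "mon_degree (squarefree_exponent T) = d"
    using assms(2)
    by (auto simp: circuit_exponents_def exponents_def keys_squarefree_exponent mon_degree_squarefree_exponent)
qed

lemma betti_circuit_ideal_nonzero:
  assumes "C \<subseteq> all_circuits n d" "C \<noteq> {}"
  shows "betti n (ideal_module n (circuit_ideal (K::'k::field itself) n C)) 0 (int d) \<noteq> 0"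
proof -
  obtain T where T: "T \<in> C" using assms by blast
  note T' = squarefree_in_circuit_exponents[OF assms(1) T]
  show ?thesis
    using betti_minimal_degree_nonzero[OF upset_circuit_exponents[OF assms(1)] T'(1), where 'k='k]
      circuit_exponents_degree[OF assms(1)] T'(2)
    by (simp add: circuit_ideal_eq[OF assms(1)])
qed

lemma indeg_circuit_ideal:
  assumes "C \<subseteq> all_circuits n d" "C \<noteq> {}"
  shows "indeg (ideal_module n (circuit_ideal (K::'k::field itself) n C)) = int d"
  unfolding indeg_def
proof (rule cInf_eq_minimum)
  obtain T where T: "T \<in> C" using assms by blast
  note T' = squarefree_in_circuit_exponents[OF assms(1) T]
  let ?t = "single (squarefree_exponent T) (1::'k)"
  have "?t \<in> part (ideal_module n (circuit_ideal K n C)) (int d)"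
    using T' by (auto simp: ideal_module_def circuit_ideal_eq[OF assms(1)] monomial_span_def poly_part_eq
        circuit_exponents_def)
  moreover have "?t \<noteq> 0" by (metis lookup_single_eq lookup_zero zero_neq_one)
  ultimately show "int d \<in> {i. part (ideal_module n (circuit_ideal K n C)) i \<noteq> {0}}" by blast
next
  fix i assume "i \<in> {i. part (ideal_module n (circuit_ideal K n C)) i \<noteq> {0}}"
  then have ne: "part (ideal_module n (circuit_ideal K n C)) i \<noteq> {0}" by simp
  have "0 \<in> part (ideal_module n (circuit_ideal K n C)) i"
    by (simp add: ideal_module_def circuit_ideal_eq[OF assms(1)] monomial_span_def poly_part_eq)
  then obtain f where f: "f \<in> part (ideal_module n (circuit_ideal K n C)) i" "f \<noteq> 0" using ne by blast
  then have "keys f \<noteq> {}" by simp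
  then obtain m where "m \<in> keys f" by blast
  then have "m \<in> circuit_exponents n C" "int (mon_degree m) = i"
    using f(1) by (auto simp: ideal_module_def circuit_ideal_eq[OF assms(1)] monomial_span_def poly_part_eq)
  then show "int d \<le> i" using circuit_exponents_degree[OF assms(1)] by force
qed

lemma betti_circuit_ideal_finite:
  assumes "C \<subseteq> all_circuits n d"
  shows "finite {i. \<exists>j. betti n (ideal_module n (circuit_ideal (K::'k::field itself) n C)) i (int i + j) \<noteq> 0}"
proof (rule finite_subset)
  interpret chosen: residue_resolution n "residue_field_resolution n :: 'k free_complex"
    by (rule residue_resolution_chosen)
  let ?G = "squarefree_exponent ` C"
  have fin: "finite ?G" by (intro finite_imageI finite_subset[OF assms all_circuits_finite(1)])
  have "squarefree_exponent T \<in> exponents n" if "T \<in> C" for T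
    using squarefree_in_circuit_exponents(1)[OF assms that] by (simp add: circuit_exponents_def)
  then have "?G \<subseteq> exponents n" by blast
  from chosen.tor_dimension_Taylor[OF fin this]
  have "betti n (ideal_module n (circuit_ideal K n C)) i j = 0" if "card ?G < i" for i j
    using that by (simp add: betti_circuit_ideal[OF assms] circuit_exponents_generated[OF assms])
  then show "{i. \<exists>j. betti n (ideal_module n (circuit_ideal K n C)) i (int i + j) \<noteq> 0} \<subseteq> {..card ?G}"
    by (auto simp: not_less[symmetric])
qed simp

theorem theorem2p1:
  fixes K :: "'k::field itself"
    and n d :: nat
    and C A D :: "nat set set"
    and e :: "nat set"
  assumes "uniform_clutter n d C"
    and "e \<in> Simp n d C"
    and "A \<subseteq> {F \<in> C. e \<subset> F}"
    and "D = C - A"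
  shows "(\<forall>(i::nat) (j::int). j > int d \<longrightarrow>
            betti n (ideal_module n (circuit_ideal K n (clutter_compl n d C))) i (int i + j)
          = betti n (ideal_module n (circuit_ideal K n (clutter_compl n d D))) i (int i + j))
    \<and> (C \<noteq> all_circuits n d \<longrightarrow>
          reg n (ideal_module n (circuit_ideal K n (clutter_compl n d C)))
          = reg n (ideal_module n (circuit_ideal K n (clutter_compl n d D)))
        \<and> linearity_index n (circuit_ideal K n (clutter_compl n d C))
          = linearity_index n (circuit_ideal K n (clutter_compl n d D))
        \<and> projdim n (ideal_module n (circuit_ideal K n (clutter_compl n d C)))
          \<le> projdim n (ideal_module n (circuit_ideal K n (clutter_compl n d D))))"
proof -
  let ?I = "\<lambda>C. circuit_ideal K n (clutter_compl n d C)"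
  let ?b = "\<lambda>C. betti n (ideal_module n (?I C))"
  have C: "C \<subseteq> all_circuits n d" using assms(1) by (simp add: uniform_clutter_def)
  have eq: "?b C i j = ?b D i j" if "j \<noteq> int i + int d" for i j
    using betti_remove_circuits[OF C assms(2,3), where j = j and i = i and K = K] that assms(4) by simp
  have le: "?b C i j \<le> ?b D i j" for i j
    using betti_remove_circuits[OF C assms(2,3), where j = j and i = i and K = K] assms(4) by simp
  have strand: "?b C i (int i + j) = ?b D i (int i + j)" if "j > int d" for i j
    using eq[of "int i + j" i] that by simp
  have "reg n (ideal_module n (?I C)) = reg n (ideal_module n (?I D))
      \<and> linearity_index n (?I C) = linearity_index n (?I D)
      \<and> projdim n (ideal_module n (?I C)) \<le> projdim n (ideal_module n (?I D))"
    if "C \<noteq> all_circuits n d"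
  proof (intro conjI)
    have ne: "clutter_compl n d C \<noteq> {}" "clutter_compl n d D \<noteq> {}"
      using that C assms(4) by (auto simp: clutter_compl_def)
    have gen: "?b C 0 (int d) \<noteq> 0"
      by (rule betti_circuit_ideal_nonzero[OF clutter_compl_subset ne(1)])
    have le': "?b C i j \<noteq> 0 \<Longrightarrow> ?b D i j \<noteq> 0" for i j using le[of i j] by simp
    have "{ereal (real_of_int (j - int i)) | i j. ?b C i j \<noteq> 0} =
        {ereal (real_of_int (j - int i)) | i j. ?b D i j \<noteq> 0}" (is "?L = ?R")
    proof
      show "?L \<subseteq> ?R" using le' by blast
      show "?R \<subseteq> ?L"
      proof
        fix x assume "x \<in> ?R"
        then obtain i j where x: "x = ereal (real_of_int (j - int i))" "?b D i j \<noteq> 0" by blast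
        show "x \<in> ?L"
        proof (cases "j = int i + int d")
          case True
          then have "x = ereal (real_of_int (int d - int 0))" using x by simp
          then show ?thesis using gen by blast
        next
          case False
          then have "?b C i j \<noteq> 0" using x(2) eq by simp
          then show ?thesis using x(1) by blast
        qed
      qed
    qed
    then show "reg n (ideal_module n (?I C)) = reg n (ideal_module n (?I D))"
      unfolding reg_def by simp
    have "indeg (ideal_module n (?I C)) = int d" "indeg (ideal_module n (?I D)) = int d"
      using ne by (auto intro: indeg_circuit_ideal[OF clutter_compl_subset])
    then have "steps_linear n (?I C) r \<longleftrightarrow> steps_linear n (?I D) r" for r
      unfolding steps_linear_def using strand by auto
    then show "linearity_index n (?I C) = linearity_index n (?I D)"
      unfolding linearity_index_def by simp
    have "?b C 0 (int 0 + int d) \<noteq> 0" using gen by simp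
    then show "projdim n (ideal_module n (?I C)) \<le> projdim n (ideal_module n (?I D))"
      unfolding projdim_def using le'
      by (intro Max_mono betti_circuit_ideal_finite[OF clutter_compl_subset]) blast+
  qed
  then show ?thesis using strand by blast
qed

end
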